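(* There exists a polynomial-time algorithm that, given a real symmetric matrix $M$ whose support graph is bipartite, decides whether $M$ has a symmetric signing $s$ such that $M(s)$ is invertible, and if so, finds such a signing.
   Context: For a real symmetric $n\times n$ matrix $M$, a signing is an $n\times n$ matrix $s$ with entries in $\{\pm1\}$; it is symmetric if $s$ is a symmetric matrix, and $M(s)$ is the entry-wise product of $M$ and $s$. The support graph of $M$ is the undirected graph on $\{1,\dots,n\}$ with edge set $\{\{u,v\}: M[u,v]\neq 0\}$ (self-loops allowed). *)

theory Defs
  imports
    "Jordan_Normal_Form.Matrix"
    "HOL-Computational_Algebra.Polynomial"
    "HOL-Library.Log_Nat"
begin

section \<open>Signings and support graphs\<close>

definition hadamard_mat :: "real mat \<Rightarrow> real mat \<Rightarrow> real mat" where
  "hadamard_mat M s = mat (dim_row M) (dim_col M) (\<lambda>(i,j). M $$ (i,j) * s $$ (i,j))"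

definition symmetric_mat :: "real mat \<Rightarrow> bool" where
  "symmetric_mat M \<longleftrightarrow> square_mat M \<and> transpose_mat M = M"

definition is_signing :: "nat \<Rightarrow> real mat \<Rightarrow> bool" where
  "is_signing n s \<longleftrightarrow> s \<in> carrier_mat n n \<and> elements_mat s \<subseteq> {1, -1}"

definition invertible_symmetric_signing :: "real mat \<Rightarrow> real mat \<Rightarrow> bool" where
  "invertible_symmetric_signing M s \<longleftrightarrow>
     is_signing (dim_row M) s \<and> symmetric_mat s \<and> invertible_mat (hadamard_mat M s)"

text \<open>Vertices are the indices \<open>0, \<dots>, n - 1\<close>; a self-loop at \<open>u\<close> is the edge \<open>{u}\<close>.\<close>

definition support_vertices :: "real mat \<Rightarrow> nat set" where
  "support_vertices M = {..<dim_row M}"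

definition support_edges :: "real mat \<Rightarrow> nat set set" where
  "support_edges M = {{u,v} | u v. u < dim_row M \<and> v < dim_row M \<and> M $$ (u,v) \<noteq> 0}"

definition bipartite :: "'v set \<Rightarrow> 'v set set \<Rightarrow> bool" where
  "bipartite V E \<longleftrightarrow>
     (\<exists>X Y. X \<union> Y = V \<and> X \<inter> Y = {} \<and> (\<forall>e\<in>E. \<exists>x\<in>X. \<exists>y\<in>Y. e = {x,y}))"

section \<open>A random access machine over the reals\<close>

text \<open>
  Algorithms are programs of a structured random access machine.  Its memory consists of
  two-dimensional, unbounded arrays, some holding natural numbers (used for indices and
  combinatorial data) and some holding exact real numbers; a scalar is a cell with index
  \<open>(0,0)\<close>.  The operations on reals are the field operations (with \<open>x / 0 = 0\<close>) and
  comparisons; there is no rounding and no conversion of reals to naturals, and all real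
  constants are integers.
  Naturals can only be added, subtracted (truncated at 0) and compared.  As there is no
  multiplication of naturals, after \<open>t\<close> steps they have a bit length of order \<open>t\<close> at most (plus
  that of the input dimension), so that charging unit cost for operations on them is polynomially
  equivalent to charging their bit length.
\<close>

datatype iexp =
    IConst nat
  | ICell string iexp iexp
  | IAdd iexp iexp
  | ISub iexp iexp

datatype rexp =
    RConst int
  | RCell string iexp iexp
  | RAdd rexp rexp
  | RSub rexp rexp
  | RMul rexp rexp
  | RDiv rexp rexp

datatype test =
    ILess iexp iexp
  | IEq iexp iexp
  | RLess rexp rexp
  | REq rexp rexp
  | Neg test
  | Conj test test

datatype com =
    Skip
  | IAssign string iexp iexp iexp
  | RAssign string iexp iexp rexp
  | Seq com com
  | IfElse test com com
  | While test com

record state =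
  nats :: "string \<Rightarrow> nat \<Rightarrow> nat \<Rightarrow> nat"
  reals :: "string \<Rightarrow> nat \<Rightarrow> nat \<Rightarrow> real"

definition upd :: "(string \<Rightarrow> nat \<Rightarrow> nat \<Rightarrow> 'a) \<Rightarrow> string \<Rightarrow> nat \<Rightarrow> nat \<Rightarrow> 'a
    \<Rightarrow> (string \<Rightarrow> nat \<Rightarrow> nat \<Rightarrow> 'a)" where
  "upd f a i j v = f(a := (f a)(i := (f a i)(j := v)))"

fun ival :: "state \<Rightarrow> iexp \<Rightarrow> nat" where
  "ival \<sigma> (IConst k) = k"
| "ival \<sigma> (ICell a i j) = nats \<sigma> a (ival \<sigma> i) (ival \<sigma> j)"
| "ival \<sigma> (IAdd e f) = ival \<sigma> e + ival \<sigma> f"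
| "ival \<sigma> (ISub e f) = ival \<sigma> e - ival \<sigma> f"

fun rval :: "state \<Rightarrow> rexp \<Rightarrow> real" where
  "rval \<sigma> (RConst k) = of_int k"
| "rval \<sigma> (RCell a i j) = reals \<sigma> a (ival \<sigma> i) (ival \<sigma> j)"
| "rval \<sigma> (RAdd e f) = rval \<sigma> e + rval \<sigma> f"
| "rval \<sigma> (RSub e f) = rval \<sigma> e - rval \<sigma> f"
| "rval \<sigma> (RMul e f) = rval \<sigma> e * rval \<sigma> f"
| "rval \<sigma> (RDiv e f) = rval \<sigma> e / rval \<sigma> f"

fun tval :: "state \<Rightarrow> test \<Rightarrow> bool" where
  "tval \<sigma> (ILess e f) \<longleftrightarrow> ival \<sigma> e < ival \<sigma> f"
| "tval \<sigma> (IEq e f) \<longleftrightarrow> ival \<sigma> e = ival \<sigma> f"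
| "tval \<sigma> (RLess e f) \<longleftrightarrow> rval \<sigma> e < rval \<sigma> f"
| "tval \<sigma> (REq e f) \<longleftrightarrow> rval \<sigma> e = rval \<sigma> f"
| "tval \<sigma> (Neg b) \<longleftrightarrow> \<not> tval \<sigma> b"
| "tval \<sigma> (Conj b c) \<longleftrightarrow> tval \<sigma> b \<and> tval \<sigma> c"

text \<open>
  Running times depend on a weight \<open>w\<close> for real numbers: each operation (including reading a
  cell) that yields the real number \<open>x\<close> costs \<open>1 + w x\<close>, and every other operation costs 1.
\<close>

fun icost :: "iexp \<Rightarrow> nat" where
  "icost (IConst k) = 1"
| "icost (ICell a i j) = icost i + icost j + 1"
| "icost (IAdd e f) = icost e + icost f + 1"
| "icost (ISub e f) = icost e + icost f + 1"

fun rcost :: "(real \<Rightarrow> nat) \<Rightarrow> state \<Rightarrow> rexp \<Rightarrow> nat" where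
  "rcost w \<sigma> (RConst k) = 1 + w (rval \<sigma> (RConst k))"
| "rcost w \<sigma> (RCell a i j) = icost i + icost j + 1 + w (rval \<sigma> (RCell a i j))"
| "rcost w \<sigma> (RAdd e f) = rcost w \<sigma> e + rcost w \<sigma> f + 1 + w (rval \<sigma> (RAdd e f))"
| "rcost w \<sigma> (RSub e f) = rcost w \<sigma> e + rcost w \<sigma> f + 1 + w (rval \<sigma> (RSub e f))"
| "rcost w \<sigma> (RMul e f) = rcost w \<sigma> e + rcost w \<sigma> f + 1 + w (rval \<sigma> (RMul e f))"
| "rcost w \<sigma> (RDiv e f) = rcost w \<sigma> e + rcost w \<sigma> f + 1 + w (rval \<sigma> (RDiv e f))"

fun tcost :: "(real \<Rightarrow> nat) \<Rightarrow> state \<Rightarrow> test \<Rightarrow> nat" where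
  "tcost w \<sigma> (ILess e f) = icost e + icost f + 1"
| "tcost w \<sigma> (IEq e f) = icost e + icost f + 1"
| "tcost w \<sigma> (RLess e f) = rcost w \<sigma> e + rcost w \<sigma> f + 1"
| "tcost w \<sigma> (REq e f) = rcost w \<sigma> e + rcost w \<sigma> f + 1"
| "tcost w \<sigma> (Neg b) = tcost w \<sigma> b + 1"
| "tcost w \<sigma> (Conj b c) = tcost w \<sigma> b + tcost w \<sigma> c + 1"

text \<open>\<open>exec w c \<sigma> t \<tau>\<close>: started in \<open>\<sigma>\<close>, the program \<open>c\<close> halts in \<open>\<tau>\<close> after time \<open>t\<close>.\<close>

inductive exec :: "(real \<Rightarrow> nat) \<Rightarrow> com \<Rightarrow> state \<Rightarrow> nat \<Rightarrow> state \<Rightarrow> bool"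
  for w :: "real \<Rightarrow> nat" where
  Skip: "exec w Skip \<sigma> 1 \<sigma>"
| IAssign: "exec w (IAssign a i j e) \<sigma> (icost i + icost j + icost e + 1)
    (\<sigma>\<lparr>nats := upd (nats \<sigma>) a (ival \<sigma> i) (ival \<sigma> j) (ival \<sigma> e)\<rparr>)"
| RAssign: "exec w (RAssign a i j e) \<sigma> (icost i + icost j + rcost w \<sigma> e + 1)
    (\<sigma>\<lparr>reals := upd (reals \<sigma>) a (ival \<sigma> i) (ival \<sigma> j) (rval \<sigma> e)\<rparr>)"
| Seq: "exec w c \<sigma> t \<tau> \<Longrightarrow> exec w d \<tau> u \<upsilon> \<Longrightarrow> exec w (Seq c d) \<sigma> (t + u) \<upsilon>"
| IfTrue: "tval \<sigma> b \<Longrightarrow> exec w c \<sigma> t \<tau> \<Longrightarrow>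
    exec w (IfElse b c d) \<sigma> (tcost w \<sigma> b + t + 1) \<tau>"
| IfFalse: "\<not> tval \<sigma> b \<Longrightarrow> exec w d \<sigma> t \<tau> \<Longrightarrow>
    exec w (IfElse b c d) \<sigma> (tcost w \<sigma> b + t + 1) \<tau>"
| WhileFalse: "\<not> tval \<sigma> b \<Longrightarrow> exec w (While b c) \<sigma> (tcost w \<sigma> b + 1) \<sigma>"
| WhileTrue: "tval \<sigma> b \<Longrightarrow> exec w c \<sigma> t \<tau> \<Longrightarrow> exec w (While b c) \<tau> u \<upsilon> \<Longrightarrow>
    exec w (While b c) \<sigma> (tcost w \<sigma> b + t + u + 1) \<upsilon>"

inductive_cases exec_elims:
  "exec w Skip \<sigma> t \<tau>"
  "exec w (IAssign a i j e) \<sigma> t \<tau>"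
  "exec w (RAssign a i j f) \<sigma> t \<tau>"
  "exec w (Seq c d) \<sigma> t \<tau>"
  "exec w (IfElse b c d) \<sigma> t \<tau>"
  "exec w (While b c) \<sigma> t \<tau>"

lemma exec_final_unique:
  "exec w c \<sigma> t \<tau> \<Longrightarrow> exec w' c \<sigma> t' \<tau>' \<Longrightarrow> \<tau>' = \<tau>"
  by (induction arbitrary: t' \<tau>' rule: exec.induct) (blast elim: exec_elims)+

lemma exec_deterministic:
  "exec w c \<sigma> t \<tau> \<Longrightarrow> exec w c \<sigma> t' \<tau>' \<Longrightarrow> t' = t \<and> \<tau>' = \<tau>"
proof (induction arbitrary: t' \<tau>' rule: exec.induct)
  case (Skip \<sigma>)
  then show ?case by (auto elim: exec_elims(1))
next
  case (IAssign a i j e \<sigma>)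
  then show ?case by (auto elim: exec_elims(2))
next
  case (RAssign a i j e \<sigma>)
  then show ?case by (auto elim: exec_elims(3))
next
  case (Seq c \<sigma> t \<tau> d u \<upsilon>)
  from Seq.prems show ?case by (rule exec_elims(4)) (metis Seq.IH)+
next
  case (IfTrue \<sigma> b c t \<tau> d)
  from IfTrue.prems show ?case by (rule exec_elims(5)) (metis Suc_eq_plus1 IfTrue.hyps(1) IfTrue.IH)+
next
  case (IfFalse \<sigma> b d t \<tau> c)
  from IfFalse.prems show ?case by (rule exec_elims(5)) (metis Suc_eq_plus1 IfFalse.hyps(1) IfFalse.IH)+
next
  case (WhileFalse \<sigma> b c)
  from WhileFalse.prems show ?case by (rule exec_elims(6)) (metis Suc_eq_plus1 WhileFalse.hyps)+
next
  case (WhileTrue \<sigma> b c t \<tau> u \<upsilon>)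
  from WhileTrue.prems show ?case by (rule exec_elims(6)) (metis Suc_eq_plus1 WhileTrue.hyps(1) WhileTrue.IH)+
qed

section \<open>Cost measures\<close>

abbreviation unit_weight :: "real \<Rightarrow> nat" where
  "unit_weight \<equiv> (\<lambda>_. 0)"

text \<open>
  The number of binary digits of numerator and denominator in lowest terms.
  This is meaningful for rational \<open>x\<close> only, and only used when all inputs (and hence all
  numbers arising in a computation) are rational.
\<close>

definition bit_weight :: "real \<Rightarrow> nat" where
  "bit_weight x = (case quotient_of (THE r. x = of_rat r) of
     (p, q) \<Rightarrow> floorlog 2 (nat \<bar>p\<bar>) + floorlog 2 (nat q))"

definition bit_size :: "real mat \<Rightarrow> nat" where
  "bit_size M = (\<Sum>i<dim_row M. \<Sum>j<dim_col M. bit_weight (M $$ (i,j)))"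

section \<open>Input and output\<close>

definition input_state :: "real mat \<Rightarrow> state" where
  "input_state M = \<lparr>
     nats = upd (\<lambda>_ _ _. 0) ''n'' 0 0 (dim_row M),
     reals = (\<lambda>a i j. if a = ''M'' \<and> i < dim_row M \<and> j < dim_col M then M $$ (i,j) else 0)\<rparr>"

definition accepts :: "state \<Rightarrow> bool" where
  "accepts \<sigma> \<longleftrightarrow> nats \<sigma> ''answer'' 0 0 = 1"

definition output_mat :: "nat \<Rightarrow> state \<Rightarrow> real mat" where
  "output_mat n \<sigma> = mat n n (\<lambda>(i,j). reals \<sigma> ''s'' i j)"

text \<open>
  On the inputs in \<open>D\<close>, the program \<open>c\<close> halts with a final state in relation \<open>Q\<close> to the input.
  The number of operations is polynomial in the dimension for all real inputs, and for rational
  inputs the bit complexity is polynomial in the length of the binary encoding of the input.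
\<close>

definition poly_time_algorithm :: "com \<Rightarrow> real mat set \<Rightarrow> (real mat \<Rightarrow> state \<Rightarrow> bool) \<Rightarrow> bool" where
  "poly_time_algorithm c D Q \<longleftrightarrow>
     (\<exists>p q :: nat poly. \<forall>M\<in>D. \<exists>\<tau>. Q M \<tau> \<and>
        (\<exists>t. exec unit_weight c (input_state M) t \<tau> \<and> t \<le> poly p (dim_row M)) \<and>
        (elements_mat M \<subseteq> \<rat> \<longrightarrow>
          (\<exists>t. exec bit_weight c (input_state M) t \<tau> \<and> t \<le> poly q (bit_size M))))"

end

theory Submission
  imports Defs "Jordan_Normal_Form.Determinant"
begin

text \<open>
  If some \<open>M(s)\<close> is invertible, the Leibniz formula yields a permutation supported on the nonzero
  entries of \<open>M\<close>.  Conversely, a perfect matching of the support graph gives an invertible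
  symmetric matrix \<open>G\<close> carrying only the matching entries, and the other edges can be added one at
  a time.  Since the graph is bipartite, \<open>B = G\<^sup>-\<^sup>1\<close> vanishes on pairs of vertices of the same
  side, so adding the value \<open>a\<close> at \<open>(u,v)\<close> and \<open>(v,u)\<close> keeps \<open>G\<close> invertible as soon as
  \<open>1 + a B[u,v] \<noteq> 0\<close>, and this holds for \<open>a = M[u,v]\<close> or for \<open>a = - M[u,v]\<close>.  The inverse is
  updated by an explicit formula; by Cramer's rule its entries stay of polynomial bit length.

  The matching is found by an auction.  A free vertex takes its cheapest neighbour, raises the price
  of that neighbour by one, and the evicted partner bids next.  If all neighbours of the bidder cost
  at least \<open>n\<close>, some price level in \<open>{1..n}\<close> is not attained; the bidder and the partners of the
  vertices above that level have all their neighbours above it, violating Hall's condition.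
\<close>

section \<open>Total correctness with cost bounds\<close>

text \<open>The obstacle is the bit complexity: up to quadratically many updates of the inverse are
  chained, and the naive bound on bit lengths more than doubles with every operation. It does not
  accumulate, because at every stage \<open>B\<close> is the exact inverse of a matrix whose entries
  are 0 or plus or minus \<open>M[i,j]\<close>. Cramer's rule bounds it afresh each time, and only a
  fixed number of operations lies between two stages. Hence the levels \<open>L k\<close>, with such
  inverses at level 0. One correctness proof then serves both cost measures: all levels are
  \<open>UNIV\<close> for counting operations and sets of bounded fractions for bit lengths, and
  determinism of the machine identifies the two final states.

  Prices are used instead of augmenting paths because a bid changes only a few cells, no path has to
  be stored, and the sum of the prices is a termination measure.\<close>

fun rsize :: "rexp \<Rightarrow> nat" where
  "rsize (RConst k) = 1"
| "rsize (RCell a i j) = icost i + icost j + 1"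
| "rsize (RAdd e f) = rsize e + rsize f + 1"
| "rsize (RSub e f) = rsize e + rsize f + 1"
| "rsize (RMul e f) = rsize e + rsize f + 1"
| "rsize (RDiv e f) = rsize e + rsize f + 1"

fun tsize :: "test \<Rightarrow> nat" where
  "tsize (ILess e f) = icost e + icost f + 1"
| "tsize (IEq e f) = icost e + icost f + 1"
| "tsize (RLess e f) = rsize e + rsize f + 1"
| "tsize (REq e f) = rsize e + rsize f + 1"
| "tsize (Neg b) = tsize b + 1"
| "tsize (Conj b c) = tsize b + tsize c + 1"

text \<open>The machine charges for intermediate results, so every subexpression has to stay in
  \<open>V\<close>, not only the final value.\<close>

fun values_in :: "real set \<Rightarrow> state \<Rightarrow> rexp \<Rightarrow> bool" where
  "values_in V \<sigma> (RConst k) \<longleftrightarrow> of_int k \<in> V"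
| "values_in V \<sigma> (RCell a i j) \<longleftrightarrow> rval \<sigma> (RCell a i j) \<in> V"
| "values_in V \<sigma> (RAdd e f) \<longleftrightarrow> values_in V \<sigma> e \<and> values_in V \<sigma> f \<and> rval \<sigma> (RAdd e f) \<in> V"
| "values_in V \<sigma> (RSub e f) \<longleftrightarrow> values_in V \<sigma> e \<and> values_in V \<sigma> f \<and> rval \<sigma> (RSub e f) \<in> V"
| "values_in V \<sigma> (RMul e f) \<longleftrightarrow> values_in V \<sigma> e \<and> values_in V \<sigma> f \<and> rval \<sigma> (RMul e f) \<in> V"
| "values_in V \<sigma> (RDiv e f) \<longleftrightarrow> values_in V \<sigma> e \<and> values_in V \<sigma> f \<and> rval \<sigma> (RDiv e f) \<in> V"

fun test_values_in :: "real set \<Rightarrow> state \<Rightarrow> test \<Rightarrow> bool" where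
  "test_values_in V \<sigma> (ILess e f) \<longleftrightarrow> True"
| "test_values_in V \<sigma> (IEq e f) \<longleftrightarrow> True"
| "test_values_in V \<sigma> (RLess e f) \<longleftrightarrow> values_in V \<sigma> e \<and> values_in V \<sigma> f"
| "test_values_in V \<sigma> (REq e f) \<longleftrightarrow> values_in V \<sigma> e \<and> values_in V \<sigma> f"
| "test_values_in V \<sigma> (Neg b) \<longleftrightarrow> test_values_in V \<sigma> b"
| "test_values_in V \<sigma> (Conj b c) \<longleftrightarrow> test_values_in V \<sigma> b \<and> test_values_in V \<sigma> c"

text \<open>\<open>N\<close> bounds the number of iterations of every loop.\<close>

fun cbound :: "nat \<Rightarrow> com \<Rightarrow> nat" where
  "cbound N Skip = 1"
| "cbound N (IAssign a i j e) = icost i + icost j + icost e + 1"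
| "cbound N (RAssign a i j e) = icost i + icost j + rsize e + 1"
| "cbound N (Seq c d) = cbound N c + cbound N d"
| "cbound N (IfElse b c d) = tsize b + cbound N c + cbound N d + 1"
| "cbound N (While b c) = (N + 1) * (tsize b + cbound N c + 1)"

lemma cbound_poly: "\<exists>p. \<forall>N. cbound N c = poly p N"
proof (induction c)
  case (Seq c d)
  then obtain p q where "\<forall>N. cbound N c = poly p N" "\<forall>N. cbound N d = poly q N" by blast
  then have "\<forall>N. cbound N (Seq c d) = poly (p + q) N" by simp
  then show ?case by blast
next
  case (IfElse b c d)
  then obtain p q where "\<forall>N. cbound N c = poly p N" "\<forall>N. cbound N d = poly q N" by blast
  then have "\<forall>N. cbound N (IfElse b c d) = poly ([:tsize b + 1:] + p + q) N" by simp
  then show ?case by blast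
next
  case (While b c)
  then obtain p where "\<forall>N. cbound N c = poly p N" by blast
  then have "\<forall>N. cbound N (While b c) = poly ([:1, 1:] * ([:tsize b + 1:] + p)) N"
    by (simp add: algebra_simps)
  then show ?case by blast
qed (auto intro: exI[of _ "[:_:]"])

lemma rcost_le:
  assumes "\<forall>x\<in>V. w x \<le> B" and "values_in V \<sigma> e"
  shows "rcost w \<sigma> e \<le> rsize e * (B + 1)"
  using assms(2)
proof (induction e)
  case (RConst k)
  then show ?case using assms(1) by (simp del: of_int_0 of_int_1)
next
  case (RCell a i j)
  then have "w (reals \<sigma> a (ival \<sigma> i) (ival \<sigma> j)) \<le> B" using assms(1) by simp
  then show ?case by (simp add: algebra_simps)
next
  case (RAdd e f)
  then have "w (rval \<sigma> e + rval \<sigma> f) \<le> B" using assms(1) by simp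
  with RAdd show ?case by (simp add: algebra_simps)
next
  case (RSub e f)
  then have "w (rval \<sigma> e - rval \<sigma> f) \<le> B" using assms(1) by simp
  with RSub show ?case by (simp add: algebra_simps)
next
  case (RMul e f)
  then have "w (rval \<sigma> e * rval \<sigma> f) \<le> B" using assms(1) by simp
  with RMul show ?case by (simp add: algebra_simps)
next
  case (RDiv e f)
  then have "w (rval \<sigma> e / rval \<sigma> f) \<le> B" using assms(1) by simp
  with RDiv show ?case by (simp add: algebra_simps)
qed

lemma tcost_le:
  assumes "\<forall>x\<in>V. w x \<le> B" and "test_values_in V \<sigma> b"
  shows "tcost w \<sigma> b \<le> tsize b * (B + 1)"
  using assms(2)
proof (induction b)
  case (RLess e f)
  then show ?case using rcost_le[OF assms(1), of \<sigma> e] rcost_le[OF assms(1), of \<sigma> f]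
    by (simp add: algebra_simps)
next
  case (REq e f)
  then show ?case using rcost_le[OF assms(1), of \<sigma> e] rcost_le[OF assms(1), of \<sigma> f]
    by (simp add: algebra_simps)
qed (simp_all add: algebra_simps)

text \<open>
  The bound is uniform in the weight \<open>w\<close>, so that a single correctness proof covers both cost
  measures; \<open>V\<close> contains all real numbers that arise during the run.
\<close>

definition runs :: "real set \<Rightarrow> com \<Rightarrow> state \<Rightarrow> nat \<Rightarrow> state \<Rightarrow> bool" where
  "runs V c \<sigma> k \<tau> \<longleftrightarrow>
     (\<forall>w B. (\<forall>x\<in>V. w x \<le> B) \<longrightarrow> (\<exists>t. exec w c \<sigma> t \<tau> \<and> t \<le> k * (B + 1)))"

text \<open>The time bound depends only on the program text and on \<open>N\<close>, never on the
  state, which is what makes it polynomial. As a function of \<open>Q\<close> this acts like a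
  weakest precondition, so programs are processed from front to back.\<close>

definition ok :: "real set \<Rightarrow> nat \<Rightarrow> com \<Rightarrow> state \<Rightarrow> (state \<Rightarrow> bool) \<Rightarrow> bool" where
  "ok V N c \<sigma> Q \<longleftrightarrow> (\<exists>\<tau>. runs V c \<sigma> (cbound N c) \<tau> \<and> Q \<tau>)"

section \<open>Proof rules for assignments, sequencing, branching and loops\<close>

lemma runsI:
  assumes "\<And>w B. \<forall>x\<in>V. w x \<le> B \<Longrightarrow> \<exists>t. exec w c \<sigma> t \<tau> \<and> t \<le> k * (B + 1)"
  shows "runs V c \<sigma> k \<tau>"
  using assms by (auto simp: runs_def)

lemma runsE:
  assumes "runs V c \<sigma> k \<tau>" and "\<forall>x\<in>V. w x \<le> B"
  obtains t where "exec w c \<sigma> t \<tau>" "t \<le> k * (B + 1)"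
  using assms unfolding runs_def by blast

lemma ok_conseq: "ok V N c \<sigma> Q \<Longrightarrow> (\<And>\<tau>. Q \<tau> \<Longrightarrow> R \<tau>) \<Longrightarrow> ok V N c \<sigma> R"
  by (auto simp: ok_def)

lemma ok_Skip: "Q \<sigma> \<Longrightarrow> ok V N Skip \<sigma> Q"
  unfolding ok_def by (rule exI[of _ \<sigma>]) (auto intro!: runsI exec.Skip exI[of _ 1])

lemma ok_IAssign:
  assumes "Q (\<sigma>\<lparr>nats := upd (nats \<sigma>) a (ival \<sigma> i) (ival \<sigma> j) (ival \<sigma> e)\<rparr>)"
  shows "ok V N (IAssign a i j e) \<sigma> Q"
  unfolding ok_def
  by (intro exI conjI, rule runsI, intro exI conjI, rule exec.IAssign, simp, rule assms)

lemma ok_RAssign: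
  assumes "values_in V \<sigma> e"
    and "Q (\<sigma>\<lparr>reals := upd (reals \<sigma>) a (ival \<sigma> i) (ival \<sigma> j) (rval \<sigma> e)\<rparr>)"
  shows "ok V N (RAssign a i j e) \<sigma> Q"
  unfolding ok_def
proof (intro exI conjI, rule runsI, intro exI conjI, rule exec.RAssign)
  fix w :: "real \<Rightarrow> nat" and B assume "\<forall>x\<in>V. w x \<le> B"
  from rcost_le[OF this assms(1)]
  show "icost i + icost j + rcost w \<sigma> e + 1 \<le> cbound N (RAssign a i j e) * (B + 1)"
    by (simp add: algebra_simps)
qed (rule assms)

lemma runs_Seq:
  assumes "runs V c \<sigma> k \<tau>" and "runs V d \<tau> l \<upsilon>"
  shows "runs V (Seq c d) \<sigma> (k + l) \<upsilon>"
proof (rule runsI)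
  fix w :: "real \<Rightarrow> nat" and B assume B: "\<forall>x\<in>V. w x \<le> B"
  obtain t where t: "exec w c \<sigma> t \<tau>" "t \<le> k * (B + 1)" using runsE[OF assms(1) B] .
  obtain u where u: "exec w d \<tau> u \<upsilon>" "u \<le> l * (B + 1)" using runsE[OF assms(2) B] .
  show "\<exists>t. exec w (Seq c d) \<sigma> t \<upsilon> \<and> t \<le> (k + l) * (B + 1)"
    using exec.Seq[OF t(1) u(1)] t(2) u(2)
    by (intro exI[of _ "t + u"]) (auto simp: algebra_simps)
qed

lemma ok_Seq: "ok V N c \<sigma> (\<lambda>\<tau>. ok V N d \<tau> Q) \<Longrightarrow> ok V N (Seq c d) \<sigma> Q"
  by (auto simp: ok_def intro: runs_Seq)

lemma ok_IfElse:
  assumes b: "test_values_in V \<sigma> b"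
    and "tval \<sigma> b \<Longrightarrow> ok V N c \<sigma> Q" and "\<not> tval \<sigma> b \<Longrightarrow> ok V N d \<sigma> Q"
  shows "ok V N (IfElse b c d) \<sigma> Q"
proof -
  obtain \<tau> where Q: "Q \<tau>" and
    \<tau>: "if tval \<sigma> b then runs V c \<sigma> (cbound N c) \<tau> else runs V d \<sigma> (cbound N d) \<tau>"
    using assms(2,3) by (cases "tval \<sigma> b") (auto simp: ok_def)
  have "runs V (IfElse b c d) \<sigma> (cbound N (IfElse b c d)) \<tau>"
  proof (rule runsI)
    fix w :: "real \<Rightarrow> nat" and B assume B: "\<forall>x\<in>V. w x \<le> B"
    note tc = tcost_le[OF B b]
    show "\<exists>t. exec w (IfElse b c d) \<sigma> t \<tau> \<and> t \<le> cbound N (IfElse b c d) * (B + 1)"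
    proof (cases "tval \<sigma> b")
      case True
      then obtain t where t: "exec w c \<sigma> t \<tau>" "t \<le> cbound N c * (B + 1)"
        using runsE[OF _ B, of c] \<tau> by (metis (full_types))
      with exec.IfTrue[OF True t(1), of d] tc show ?thesis
        by (intro exI[of _ "tcost w \<sigma> b + t + 1"]) (auto simp: algebra_simps)
    next
      case False
      then obtain t where t: "exec w d \<sigma> t \<tau>" "t \<le> cbound N d * (B + 1)"
        using runsE[OF _ B, of d] \<tau> by (metis (full_types))
      with exec.IfFalse[OF False t(1), of c] tc show ?thesis
        by (intro exI[of _ "tcost w \<sigma> b + t + 1"]) (auto simp: algebra_simps)
    qed
  qed
  with Q show ?thesis by (auto simp: ok_def)
qed

lemma ok_While:
  assumes inv: "I \<sigma>" and m: "m \<sigma> \<le> N"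
    and b: "\<And>\<sigma>. I \<sigma> \<Longrightarrow> test_values_in V \<sigma> b"
    and step: "\<And>\<sigma>. I \<sigma> \<Longrightarrow> tval \<sigma> b \<Longrightarrow> ok V N c \<sigma> (\<lambda>\<tau>. I \<tau> \<and> (m \<tau> :: nat) < m \<sigma>)"
    and Q: "\<And>\<sigma>. I \<sigma> \<Longrightarrow> \<not> tval \<sigma> b \<Longrightarrow> Q \<sigma>"
  shows "ok V N (While b c) \<sigma> Q"
proof -
  let ?l = "tsize b + cbound N c + 1"
  \<comment> \<open>The induction needs a bound for the iterations still to come, so
    \<open>m \<sigma>\<close> stands here in place of \<open>N\<close> and is replaced only at the
    end.\<close>
  have "\<exists>\<tau>. runs V (While b c) \<sigma> ((m \<sigma> + 1) * ?l) \<tau> \<and> I \<tau> \<and> \<not> tval \<tau> b"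
    using inv
  proof (induction "m \<sigma>" arbitrary: \<sigma> rule: less_induct)
    case less
    note tc = tcost_le[OF _ b[OF less.prems]]
    show ?case
    proof (cases "tval \<sigma> b")
      case True
      obtain \<tau> where \<tau>: "runs V c \<sigma> (cbound N c) \<tau>" "I \<tau>" "m \<tau> < m \<sigma>"
        using step[OF less.prems True] by (auto simp: ok_def)
      obtain \<upsilon> where \<upsilon>: "runs V (While b c) \<tau> ((m \<tau> + 1) * ?l) \<upsilon>" "I \<upsilon>" "\<not> tval \<upsilon> b"
        using less.hyps[OF \<tau>(3,2)] by blast
      have "runs V (While b c) \<sigma> ((m \<sigma> + 1) * ?l) \<upsilon>"
      proof (rule runsI)
        fix w :: "real \<Rightarrow> nat" and B assume B: "\<forall>x\<in>V. w x \<le> B"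
        obtain t where t: "exec w c \<sigma> t \<tau>" "t \<le> cbound N c * (B + 1)" using runsE[OF \<tau>(1) B] .
        obtain u where u: "exec w (While b c) \<tau> u \<upsilon>" "u \<le> (m \<tau> + 1) * ?l * (B + 1)"
          using runsE[OF \<upsilon>(1) B] .
        have "tcost w \<sigma> b + t + u + 1 \<le> ?l * (B + 1) + (m \<tau> + 1) * ?l * (B + 1)"
          using tc[OF B] t(2) u(2) by (simp add: algebra_simps)
        also have "\<dots> = (m \<tau> + 1 + 1) * (?l * (B + 1))" by (simp add: algebra_simps)
        also have "\<dots> \<le> (m \<sigma> + 1) * (?l * (B + 1))" using \<tau>(3) by (intro mult_right_mono) auto
        finally show "\<exists>t. exec w (While b c) \<sigma> t \<upsilon> \<and> t \<le> (m \<sigma> + 1) * ?l * (B + 1)"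
          using exec.WhileTrue[OF True t(1) u(1)] by (metis mult.assoc)
      qed
      with \<upsilon> show ?thesis by blast
    next
      case False
      have "runs V (While b c) \<sigma> ((m \<sigma> + 1) * ?l) \<sigma>"
      proof (rule runsI)
        fix w :: "real \<Rightarrow> nat" and B assume B: "\<forall>x\<in>V. w x \<le> B"
        have "tcost w \<sigma> b + 1 \<le> 1 * (?l * (B + 1))" using tc[OF B] by (simp add: algebra_simps)
        also have "\<dots> \<le> (m \<sigma> + 1) * (?l * (B + 1))" by (intro mult_right_mono) auto
        finally show "\<exists>t. exec w (While b c) \<sigma> t \<sigma> \<and> t \<le> (m \<sigma> + 1) * ?l * (B + 1)"
          using exec.WhileFalse[OF False] by (metis mult.assoc)
      qed
      with False less.prems show ?thesis by blast
    qed
  qed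
  then obtain \<tau> where \<tau>: "runs V (While b c) \<sigma> ((m \<sigma> + 1) * ?l) \<tau>" "I \<tau>" "\<not> tval \<tau> b" by blast
  have "(m \<sigma> + 1) * ?l * (B + 1) \<le> cbound N (While b c) * (B + 1)" for B
    using m by (simp only: cbound.simps, intro mult_right_mono) auto
  with \<tau>(1) have "runs V (While b c) \<sigma> (cbound N (While b c)) \<tau>"
    unfolding runs_def by (meson order_trans)
  with Q[OF \<tau>(2,3)] show ?thesis by (auto simp: ok_def)
qed

text \<open>Memory is rewritten a row at a time because invariants speak of whole rows such as
  \<open>nats \<sigma> ''mu'' 0\<close>.\<close>

lemma upd_row: "upd f a i j v a' i' = (if a' = a \<and> i' = i then (f a i)(j := v) else f a' i')"
  by (auto simp: upd_def)

section \<open>Counting loops and frame conditions\<close>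

abbreviation cell :: "string \<Rightarrow> iexp" where
  "cell a \<equiv> ICell a (IConst 0) (IConst 0)"

abbreviation set_cell :: "string \<Rightarrow> iexp \<Rightarrow> com" where
  "set_cell a e \<equiv> IAssign a (IConst 0) (IConst 0) e"

definition for_loop :: "string \<Rightarrow> string \<Rightarrow> com \<Rightarrow> com" where
  "for_loop x y c = Seq (set_cell x (IConst 0))
     (While (ILess (cell x) (cell y)) (Seq c (set_cell x (IAdd (cell x) (IConst 1)))))"

abbreviation set_nat :: "string \<Rightarrow> nat \<Rightarrow> state \<Rightarrow> state" where
  "set_nat x k \<sigma> \<equiv> \<sigma>\<lparr>nats := upd (nats \<sigma>) x 0 0 k\<rparr>"

text \<open>\<open>I k\<close> describes the state at the loop test with counter value
  \<open>k\<close>; the body therefore has to establish \<open>I (Suc k)\<close> for the state in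
  which the counter has already been raised.\<close>

lemma ok_for_loop:
  assumes xy: "x \<noteq> y" and n: "nats \<sigma> y 0 0 = n" "n \<le> N"
    and start: "I 0 (set_nat x 0 \<sigma>)"
    and step: "\<And>k \<sigma>. I k \<sigma> \<Longrightarrow> k < n \<Longrightarrow> nats \<sigma> x 0 0 = k \<Longrightarrow> nats \<sigma> y 0 0 = n \<Longrightarrow>
      ok V N c \<sigma> (\<lambda>\<tau>. nats \<tau> x 0 0 = k \<and> nats \<tau> y 0 0 = n \<and> I (Suc k) (set_nat x (Suc k) \<tau>))"
    and Q: "\<And>\<sigma>. I n \<sigma> \<Longrightarrow> Q \<sigma>"
  shows "ok V N (for_loop x y c) \<sigma> Q"
proof -
  let ?J = "\<lambda>\<sigma>. nats \<sigma> y 0 0 = n \<and> nats \<sigma> x 0 0 \<le> n \<and> I (nats \<sigma> x 0 0) \<sigma>"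
  have "ok V N (While (ILess (cell x) (cell y)) (Seq c (set_cell x (IAdd (cell x) (IConst 1)))))
      (set_nat x 0 \<sigma>) Q"
  proof (rule ok_While[where I = ?J and m = "\<lambda>\<sigma>. n - nats \<sigma> x 0 0"])
    show "?J (set_nat x 0 \<sigma>)" using start xy n by (simp add: upd_row)
  next
    fix \<sigma> assume J: "?J \<sigma>" and t: "tval \<sigma> (ILess (cell x) (cell y))"
    then have "nats \<sigma> x 0 0 < n" by simp
    then show "ok V N (Seq c (set_cell x (IAdd (cell x) (IConst 1)))) \<sigma>
        (\<lambda>\<tau>. ?J \<tau> \<and> n - nats \<tau> x 0 0 < n - nats \<sigma> x 0 0)"
      using J xy by (intro ok_Seq ok_conseq[OF step] ok_IAssign) (auto simp: upd_row)
  next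
    fix \<sigma> assume "?J \<sigma>" "\<not> tval \<sigma> (ILess (cell x) (cell y))"
    then have "nats \<sigma> x 0 0 = n" "I (nats \<sigma> x 0 0) \<sigma>" by auto
    then show "Q \<sigma>" using Q[of \<sigma>] by simp
  qed (use n in auto)
  then show ?thesis unfolding for_loop_def by (intro ok_Seq ok_IAssign) simp
qed

definition frame :: "string set \<Rightarrow> string set \<Rightarrow> state \<Rightarrow> state \<Rightarrow> bool" where
  "frame S T \<sigma> \<tau> \<longleftrightarrow> (\<forall>a. a \<notin> S \<longrightarrow> nats \<tau> a = nats \<sigma> a) \<and> (\<forall>a. a \<notin> T \<longrightarrow> reals \<tau> a = reals \<sigma> a)"

lemma frameD:
  assumes "frame S T \<sigma> \<tau>"
  shows "a \<notin> S \<Longrightarrow> nats \<tau> a = nats \<sigma> a" and "a \<notin> T \<Longrightarrow> reals \<tau> a = reals \<sigma> a"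
  using assms by (auto simp: frame_def)

lemma frame_refl [simp]: "frame S T \<sigma> \<sigma>"
  by (simp add: frame_def)

text \<open>As rewrite rules these peel permitted writes off the final state one by one, until the
  state of the hypothesis is left.\<close>

lemma frame_upd:
  "a \<in> S \<Longrightarrow> frame S T \<sigma> (\<tau>\<lparr>nats := upd f a i j v\<rparr>) \<longleftrightarrow> frame S T \<sigma> (\<tau>\<lparr>nats := f\<rparr>)"
  "a \<in> T \<Longrightarrow> frame S T \<sigma> (\<tau>\<lparr>reals := upd g a i j y\<rparr>) \<longleftrightarrow> frame S T \<sigma> (\<tau>\<lparr>reals := g\<rparr>)"
  "a \<in> S \<Longrightarrow> frame S T \<sigma> (\<tau>\<lparr>nats := upd f a i j v, reals := g\<rparr>) \<longleftrightarrow>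
     frame S T \<sigma> (\<tau>\<lparr>nats := f, reals := g\<rparr>)"
  by (auto simp: frame_def upd_def)

lemma frame_trans:
  "frame S T \<sigma> \<tau> \<Longrightarrow> frame S' T' \<tau> \<upsilon> \<Longrightarrow> S \<subseteq> U \<Longrightarrow> S' \<subseteq> U \<Longrightarrow> T \<subseteq> W \<Longrightarrow> T' \<subseteq> W \<Longrightarrow>
    frame U W \<sigma> \<upsilon>"
  unfolding frame_def by (metis subsetD)

text \<open>The inner bound is read from a cell that may be the outer counter; \<open>m\<close>
  gives its value, with \<open>m k = n\<close> for all pairs and \<open>m k = k\<close> for the
  pairs below the diagonal. The invariant has to survive arbitrary changes of the counters, since
  these move between two runs of the body.\<close>

lemma ok_for_loop2:
  assumes neq: "x \<noteq> y" "z \<noteq> x" "z \<noteq> y" "z \<noteq> b" and n: "nats \<sigma> y 0 0 = n" "n \<le> N"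
    and start: "I 0 0 \<sigma>"
    and counter: "\<And>k l \<sigma> v. I k l \<sigma> \<Longrightarrow> I k l (set_nat x v \<sigma>)"
      "\<And>k l \<sigma> v. I k l \<sigma> \<Longrightarrow> I k l (set_nat z v \<sigma>)"
    and bound: "\<And>\<sigma> :: state. nats \<sigma> y 0 0 = n \<Longrightarrow> nats \<sigma> b 0 0 = m (nats \<sigma> x 0 0)"
      "\<And>k. k < n \<Longrightarrow> m k \<le> N"
    and step: "\<And>k l \<sigma>. I k l \<sigma> \<Longrightarrow> k < n \<Longrightarrow> l < m k \<Longrightarrow>
      nats \<sigma> x 0 0 = k \<Longrightarrow> nats \<sigma> z 0 0 = l \<Longrightarrow> nats \<sigma> y 0 0 = n \<Longrightarrow>
      ok V N c \<sigma> (\<lambda>\<tau>. nats \<tau> x 0 0 = k \<and> nats \<tau> z 0 0 = l \<and> nats \<tau> y 0 0 = n \<and> I k (Suc l) \<tau>)"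
    and row: "\<And>k \<sigma>. I k (m k) \<sigma> \<Longrightarrow> I (Suc k) 0 \<sigma>"
    and Q: "\<And>\<sigma>. I n 0 \<sigma> \<Longrightarrow> Q \<sigma>"
  shows "ok V N (for_loop x y (for_loop z b c)) \<sigma> Q"
proof (rule ok_for_loop[where n = n and I = "\<lambda>k. I k 0"])
  have b: "nats \<tau> b 0 0 = m k" if "nats \<tau> x 0 0 = k" "nats \<tau> y 0 0 = n" for \<tau> :: state and k
    using bound(1)[OF that(2)] that(1) by simp
  fix k \<sigma> assume k: "I k 0 \<sigma>" "k < n" "nats \<sigma> x 0 0 = k" "nats \<sigma> y 0 0 = n"
  show "ok V N (for_loop z b c) \<sigma>
      (\<lambda>\<tau>. nats \<tau> x 0 0 = k \<and> nats \<tau> y 0 0 = n \<and> I (Suc k) 0 (set_nat x (Suc k) \<tau>))"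
  proof (rule ok_for_loop[where n = "m k" and
        I = "\<lambda>l \<tau>. I k l \<tau> \<and> nats \<tau> x 0 0 = k \<and> nats \<tau> y 0 0 = n"])
    fix l \<tau> assume "I k l \<tau> \<and> nats \<tau> x 0 0 = k \<and> nats \<tau> y 0 0 = n" "l < m k" "nats \<tau> z 0 0 = l"
    moreover from this have "ok V N c \<tau> (\<lambda>\<tau>. nats \<tau> x 0 0 = k \<and> nats \<tau> z 0 0 = l \<and> nats \<tau> y 0 0 = n \<and>
        I k (Suc l) \<tau>)" using k(2) by (intro step) auto
    ultimately show "ok V N c \<tau> (\<lambda>\<tau>. nats \<tau> z 0 0 = l \<and> nats \<tau> b 0 0 = m k \<and>
        I k (Suc l) (set_nat z (Suc l) \<tau>) \<and> nats (set_nat z (Suc l) \<tau>) x 0 0 = k \<and>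
        nats (set_nat z (Suc l) \<tau>) y 0 0 = n)"
      using neq by (elim ok_conseq) (auto simp: upd_row counter(2) intro: b)
  qed (use k neq bound counter row in \<open>auto simp: upd_row\<close>)
qed (use assms in auto)

section \<open>Perfect matchings by an auction\<close>

text \<open>
  The cell \<open>mu[v]\<close> holds the partner of \<open>v\<close> plus one, and 0 if \<open>v\<close> is unmatched; likewise
  for \<open>best\<close>.
\<close>

abbreviation elem :: "string \<Rightarrow> iexp \<Rightarrow> iexp" where
  "elem a e \<equiv> ICell a (IConst 0) e"

abbreviation set_elem :: "string \<Rightarrow> iexp \<Rightarrow> iexp \<Rightarrow> com" where
  "set_elem a i e \<equiv> IAssign a (IConst 0) i e"

section \<open>The auction as a program\<close>

definition clear_prices :: com where
  "clear_prices = for_loop ''y'' ''n'' (set_elem ''p'' (cell ''y'') (IConst 0))"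

text \<open>Since \<open>bp\<close> starts at \<open>n\<close> and only smaller prices are accepted,
  \<open>best\<close> stays 0 exactly when every neighbour costs at least \<open>n\<close>, which is
  the case that refutes Hall's condition.\<close>

definition scan :: com where
  "scan = Seq (set_cell ''best'' (IConst 0)) (Seq (set_cell ''bp'' (cell ''n''))
     (for_loop ''y'' ''n''
        (IfElse (Conj (Neg (REq (RCell ''M'' (cell ''x'') (cell ''y'')) (RConst 0)))
                      (ILess (elem ''p'' (cell ''y'')) (cell ''bp'')))
           (Seq (set_cell ''best'' (IAdd (cell ''y'') (IConst 1)))
                (set_cell ''bp'' (elem ''p'' (cell ''y''))))
           Skip)))"

text \<open>\<open>best\<close> already is the shifted partner \<open>y + 1\<close>. The evicted
  vertex, also shifted by one, is kept in \<open>z\<close> before \<open>mu[y]\<close> is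
  overwritten.\<close>

definition bid :: com where
  "bid = Seq (set_cell ''y'' (ISub (cell ''best'') (IConst 1)))
    (Seq (set_cell ''z'' (elem ''mu'' (cell ''y'')))
    (Seq (set_elem ''mu'' (cell ''x'') (cell ''best''))
    (Seq (set_elem ''mu'' (cell ''y'') (IAdd (cell ''x'') (IConst 1)))
    (Seq (set_elem ''p'' (cell ''y'') (IAdd (elem ''p'' (cell ''y'')) (IConst 1)))
    (IfElse (IEq (cell ''z'') (IConst 0))
       (set_cell ''act'' (IConst 0))
       (Seq (set_cell ''x'' (ISub (cell ''z'') (IConst 1)))
            (set_elem ''mu'' (cell ''x'') (IConst 0))))))))"

text \<open>Prices are reset for each root \<open>r\<close>: roots come from both sides, while only
  vertices opposite to the current root may carry a price.\<close>

definition phase :: com where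
  "phase = Seq clear_prices (Seq (set_cell ''x'' (cell ''r'')) (Seq (set_cell ''act'' (IConst 1))
     (While (IEq (cell ''act'') (IConst 1))
       (Seq scan
         (IfElse (IEq (cell ''best'') (IConst 0))
           (Seq (set_cell ''fail'' (IConst 1)) (set_cell ''act'' (IConst 0)))
           bid)))))"

definition find_matching :: com where
  "find_matching = for_loop ''r'' ''n''
     (IfElse (Conj (IEq (cell ''fail'') (IConst 0)) (IEq (elem ''mu'' (cell ''r'')) (IConst 0)))
        phase Skip)"

text \<open>
  The set \<open>L k\<close> contains the values of expressions of depth \<open>k\<close> over the input and over inverses of
  signed submatrices.  It is \<open>UNIV\<close> for arbitrary reals, and a set of fractions with bounded
  numerators and denominators for rational inputs.
\<close>

locale bipartite_input =
  fixes n :: nat and A :: "nat \<Rightarrow> nat \<Rightarrow> real" and side :: "nat \<Rightarrow> bool"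
    and L :: "nat \<Rightarrow> real set"
  assumes A_sym: "i < n \<Longrightarrow> j < n \<Longrightarrow> A i j = A j i"
    and A_side: "i < n \<Longrightarrow> j < n \<Longrightarrow> A i j \<noteq> 0 \<Longrightarrow> side i \<noteq> side j"
    and L_const: "0 \<in> L 0" "1 \<in> L 0" "- 1 \<in> L 0"
    and L_Suc: "L k \<subseteq> L (Suc k)"
    and L_op: "x \<in> L k \<Longrightarrow> y \<in> L k \<Longrightarrow> x + y \<in> L (Suc k)"
      "x \<in> L k \<Longrightarrow> y \<in> L k \<Longrightarrow> x - y \<in> L (Suc k)"
      "x \<in> L k \<Longrightarrow> y \<in> L k \<Longrightarrow> x * y \<in> L (Suc k)"
      "x \<in> L k \<Longrightarrow> y \<in> L k \<Longrightarrow> x / y \<in> L (Suc k)"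
    and L_A: "i < n \<Longrightarrow> j < n \<Longrightarrow> A i j \<in> L 0" "i < n \<Longrightarrow> j < n \<Longrightarrow> - A i j \<in> L 0"
    and L_inverse: "(\<And>i j. i < n \<Longrightarrow> j < n \<Longrightarrow> G i j \<in> {0, A i j, - A i j}) \<Longrightarrow>
      (\<And>i j. i < n \<Longrightarrow> j < n \<Longrightarrow> (\<Sum>k<n. G i k * B k j) = of_bool (i = j)) \<Longrightarrow>
      i < n \<Longrightarrow> j < n \<Longrightarrow> B i j \<in> L 0"
begin

text \<open>Level 5 is reached by the update of \<open>B\<close>: the factor \<open>f\<close> lies
  in \<open>L 3\<close>, its product with the bracket in \<open>L 4\<close>, and the difference in
  \<open>L 5\<close>.\<close>

abbreviation V :: "real set" where "V \<equiv> L 5"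

text \<open>This covers the counting loops, with at most \<open>n\<close> rounds, and one phase of
  the auction, with at most \<open>n * n + 1\<close> rounds.\<close>

abbreviation N :: nat where "N \<equiv> (n + 1)\<^sup>2"

lemma n_le_N: "n \<le> N"
  by (simp add: power2_eq_square)

lemma L_mono: "k \<le> l \<Longrightarrow> x \<in> L k \<Longrightarrow> x \<in> L l"
  using lift_Suc_mono_le[of L, OF L_Suc] by blast

lemma L0_V: "x \<in> L 0 \<Longrightarrow> x \<in> V"
  by (rule L_mono) auto

section \<open>Invariants of the auction\<close>

definition input_ok :: "state \<Rightarrow> bool" where
  "input_ok \<sigma> \<longleftrightarrow> nats \<sigma> ''n'' 0 0 = n \<and> (\<forall>i<n. \<forall>j<n. reals \<sigma> ''M'' i j = A i j)"

text \<open>The certificate for rejection: every Leibniz term vanishes, whatever the signing.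
  Permutations are what a nonzero determinant provides and what the counting argument for the
  auction contradicts, so no detour through matchings is made.\<close>

definition no_perm :: bool where
  "no_perm \<longleftrightarrow> \<not> (\<exists>\<pi>. \<pi> permutes {..<n} \<and> (\<forall>i<n. A i (\<pi> i) \<noteq> 0))"

definition matching :: "(nat \<Rightarrow> nat) \<Rightarrow> bool" where
  "matching mu \<longleftrightarrow> (\<forall>i<n. \<forall>j. mu i = Suc j \<longrightarrow> j < n \<and> mu j = Suc i \<and> A i j \<noteq> 0)"

text \<open>The vertex \<open>r\<close> is the root of the phase, \<open>x\<close> the current
  bidder. The inequality is complementary slackness up to 1: the partner of \<open>v\<close> chose
  it as a cheapest neighbour, the price of \<open>v\<close> rose by one, and prices of the
  alternatives have only risen since. By the last conjunct all roots so far are matched, except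
  possibly the bidder.\<close>

definition phase_inv :: "nat \<Rightarrow> (nat \<Rightarrow> nat) \<Rightarrow> (nat \<Rightarrow> nat) \<Rightarrow> nat \<Rightarrow> bool" where
  "phase_inv r mu p x \<longleftrightarrow> matching mu \<and> x < n \<and> mu x = 0 \<and> side x = side r \<and>
     (\<forall>v<n. p v \<le> n) \<and>
     (\<forall>v<n. p v \<noteq> 0 \<longrightarrow> side v \<noteq> side r \<and>
        (\<exists>u. mu v = Suc u \<and> (\<forall>z<n. A u z \<noteq> 0 \<longrightarrow> p v \<le> p z + 1))) \<and>
     (\<forall>v\<le>r. v = x \<or> mu v \<noteq> 0)"

text \<open>
  At most \<open>n - 1\<close> vertices have a positive price, so some level \<open>j \<le> n\<close> is not attained.  Prices
  drop by at most 1 along an edge leaving the partner of a priced vertex, hence neighbours of the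
  partners of vertices above \<open>j\<close> lie above \<open>j\<close> again.
\<close>

lemma phase_inv_no_perm:
  assumes inv: "phase_inv r mu p x" and x: "\<And>y. y < n \<Longrightarrow> A x y \<noteq> 0 \<Longrightarrow> n \<le> p y"
  shows no_perm
  unfolding no_perm_def
proof
  assume "\<exists>\<pi>. \<pi> permutes {..<n} \<and> (\<forall>i<n. A i (\<pi> i) \<noteq> 0)"
  then obtain \<pi> where \<pi>: "\<pi> permutes {..<n}" "\<And>i. i < n \<Longrightarrow> A i (\<pi> i) \<noteq> 0" by blast
  have \<pi>n: "\<pi> i < n" if "i < n" for i using permutes_in_image[OF \<pi>(1), of i] that by simp
  have m: "\<And>i j. i < n \<Longrightarrow> mu i = Suc j \<Longrightarrow> j < n \<and> mu j = Suc i"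
    and xn: "x < n" "mu x = 0"
    and pr: "\<And>v. v < n \<Longrightarrow> p v \<noteq> 0 \<Longrightarrow>
      \<exists>u. mu v = Suc u \<and> (\<forall>z<n. A u z \<noteq> 0 \<longrightarrow> p v \<le> p z + 1)"
    using inv unfolding phase_inv_def matching_def by blast+
  \<comment> \<open>A vertex with positive price has a partner, so the bidder has price 0; this
    leaves at most \<open>n - 1\<close> vertices for the \<open>n\<close> levels.\<close>
  have px: "p x = 0" using pr[OF xn(1)] xn(2) by auto
  have "\<exists>j\<in>{1..n}. \<forall>v<n. p v \<noteq> j"
  proof (rule ccontr)
    assume "\<not> ?thesis"
    then have *: "\<exists>v<n. p v = j" if "1 \<le> j" "j \<le> n" for j using that by auto
    have "{1..n} \<subseteq> p ` ({..<n} - {x})"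
    proof
      fix j assume "j \<in> {1..n}"
      then obtain v where "v < n" "p v = j" "1 \<le> j" using * by auto
      moreover from this px have "v \<noteq> x" by auto
      ultimately show "j \<in> p ` ({..<n} - {x})" by blast
    qed
    then have "card {1..n} \<le> card (p ` ({..<n} - {x}))" by (intro card_mono) auto
    also have "\<dots> \<le> card ({..<n} - {x})" by (intro card_image_le) auto
    finally show False using xn by simp
  qed
  then obtain j where j: "1 \<le> j" "j \<le> n" "\<And>v. v < n \<Longrightarrow> p v \<noteq> j" by auto
  define H where "H = {v. v < n \<and> j < p v}"
  define f where "f v = mu v - 1" for v
  have f: "mu v = Suc (f v)" "f v < n" "mu (f v) = Suc v"
    "\<And>z. z < n \<Longrightarrow> A (f v) z \<noteq> 0 \<Longrightarrow> p v \<le> p z + 1" if "v \<in> H" for v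
  proof -
    have v: "v < n" "p v \<noteq> 0" using that by (auto simp: H_def)
    obtain u where u: "mu v = Suc u" "\<forall>z<n. A u z \<noteq> 0 \<longrightarrow> p v \<le> p z + 1" using pr[OF v] by blast
    have "f v = u" by (simp add: f_def u)
    then show "mu v = Suc (f v)" "f v < n" "mu (f v) = Suc v"
      "\<And>z. z < n \<Longrightarrow> A (f v) z \<noteq> 0 \<Longrightarrow> p v \<le> p z + 1"
      using u m[OF v(1) u(1)] by simp_all
  qed
  have fin: "finite H" by (simp add: H_def)
  have "inj_on f H" by (rule inj_onI) (metis f(3) nat.inject)
  moreover have "x \<notin> f ` H" using f(3) xn(2) by auto
  ultimately have card: "card (insert x (f ` H)) = Suc (card H)" using fin by (simp add: card_image)
  have "\<pi> ` insert x (f ` H) \<subseteq> H"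
  proof
    fix y assume "y \<in> \<pi> ` insert x (f ` H)"
    then consider "y = \<pi> x" | v where "v \<in> H" "y = \<pi> (f v)" by auto
    then show "y \<in> H"
    proof cases
      case 1
      then have "n \<le> p y" "y < n" using x[of y] \<pi>(2) \<pi>n xn by auto
      then show ?thesis using j(2) j(3)[of y] by (auto simp: H_def)
    next
      case 2
      then have "y < n" "p v \<le> p y + 1" using f[of v] \<pi>(2) \<pi>n by auto
      then show ?thesis using j(3)[of y] 2(1) by (auto simp: H_def)
    qed
  qed
  then have "card (\<pi> ` insert x (f ` H)) \<le> card H" using fin by (rule card_mono[rotated])
  then show False
    using card card_image[OF permutes_inj_on[OF \<pi>(1)], of "insert x (f ` H)"] by linarith
qed

text \<open>A free neighbour ends the phase: nobody is evicted, and \<open>x\<close> was the only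
  vertex up to \<open>r\<close> that could lack a partner.\<close>

lemma bid_free:
  assumes inv: "phase_inv r mu p x" and y: "y < n" "A x y \<noteq> 0" and free: "mu y = 0"
  shows "matching (mu(x := Suc y, y := Suc x))"
    and "\<And>v. v \<le> r \<Longrightarrow> (mu(x := Suc y, y := Suc x)) v \<noteq> 0"
proof -
  have xn: "x < n" "mu x = 0" using inv by (auto simp: phase_inv_def)
  have xy: "x \<noteq> y" using A_side[OF xn(1) y] by auto
  have mm: "\<And>i j. i < n \<Longrightarrow> mu i = Suc j \<Longrightarrow> j < n \<and> mu j = Suc i \<and> A i j \<noteq> 0"
    using inv unfolding phase_inv_def matching_def by blast
  show "matching (mu(x := Suc y, y := Suc x))"
    unfolding matching_def
  proof (intro allI impI)
    fix i j assume i: "i < n" "(mu(x := Suc y, y := Suc x)) i = Suc j"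
    show "j < n \<and> (mu(x := Suc y, y := Suc x)) j = Suc i \<and> A i j \<noteq> 0"
    proof (cases "i = x \<or> i = y")
      case True
      then show ?thesis using i xn y A_sym[OF xn(1) y(1)] xy by (auto split: if_splits)
    next
      case False
      then have "mu i = Suc j" using i(2) by simp
      from mm[OF i(1) this] show ?thesis using False xn free by auto
    qed
  qed
  show "(mu(x := Suc y, y := Suc x)) v \<noteq> 0" if "v \<le> r" for v
    using inv that by (auto simp: phase_inv_def)
qed

text \<open>The choice of a cheapest \<open>y\<close> gives the slackness condition for the new
  pair, and raising a price only weakens the conditions of the other pairs. The evicted
  \<open>z\<close> is two edges away from \<open>x\<close>, hence on the side of the root again, and
  \<open>p y < n\<close> keeps prices at most \<open>n\<close>.\<close>

lemma bid_evict:
  assumes inv: "phase_inv r mu p x" and y: "y < n" "A x y \<noteq> 0" "p y < n"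
    and min: "\<And>z. z < n \<Longrightarrow> A x z \<noteq> 0 \<Longrightarrow> p y \<le> p z" and z: "mu y = Suc z"
  shows "phase_inv r (mu(x := Suc y, y := Suc x, z := 0)) (p(y := Suc (p y))) z"
proof -
  have xn: "x < n" "mu x = 0" "side x = side r" using inv by (auto simp: phase_inv_def)
  have mm: "\<And>i j. i < n \<Longrightarrow> mu i = Suc j \<Longrightarrow> j < n \<and> mu j = Suc i \<and> A i j \<noteq> 0"
    using inv unfolding phase_inv_def matching_def by blast
  have zn: "z < n" "mu z = Suc y" "A y z \<noteq> 0" using mm[OF y(1) z] by auto
  have neq: "x \<noteq> y" "z \<noteq> y" "x \<noteq> z"
    using A_side[OF xn(1) y(1,2)] A_side[OF y(1) zn(1,3)] zn(2) xn(2) by auto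
  have sz: "side z = side r" "side y \<noteq> side r"
    using A_side[OF xn(1) y(1,2)] A_side[OF y(1) zn(1,3)] xn(3) by auto
  have Axy: "A y x \<noteq> 0" using A_sym[OF xn(1) y(1)] y(2) by simp
  let ?mu = "mu(x := Suc y, y := Suc x, z := 0)" and ?p = "p(y := Suc (p y))"
  have "matching ?mu"
    unfolding matching_def
  proof (intro allI impI)
    fix i j assume i: "i < n" "?mu i = Suc j"
    consider "i = x" | "i = y" | "i \<noteq> x" "i \<noteq> y" "i \<noteq> z" using i(2) by (cases "i = z") auto
    then show "j < n \<and> ?mu j = Suc i \<and> A i j \<noteq> 0"
    proof cases
      case 3
      then have *: "mu i = Suc j" using i(2) by simp
      with mm[OF i(1) *] 3 zn z xn show ?thesis by auto
    qed (use i neq y xn Axy in auto)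
  qed
  moreover have "side v \<noteq> side r \<and> (\<exists>u. ?mu v = Suc u \<and> (\<forall>z<n. A u z \<noteq> 0 \<longrightarrow> ?p v \<le> ?p z + 1))"
    if v: "v < n" "?p v \<noteq> 0" for v
  proof (cases "v = y")
    case True
    then show ?thesis using sz neq min by (auto intro!: exI[of _ x])
  next
    case False
    then have "p v \<noteq> 0" using v by simp
    then obtain u where u: "side v \<noteq> side r" "mu v = Suc u" "\<forall>z<n. A u z \<noteq> 0 \<longrightarrow> p v \<le> p z + 1"
      using inv v(1) by (auto simp: phase_inv_def)
    moreover have "v \<noteq> x" "v \<noteq> z" using u xn sz by auto
    ultimately show ?thesis using False by (intro conjI exI[of _ u]) (auto simp: le_SucI)
  qed
  moreover have "?p v \<le> n" if "v < n" for v
    using inv that y(3) by (auto simp: phase_inv_def)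
  moreover have "v = z \<or> ?mu v \<noteq> 0" if "v \<le> r" for v
    using inv that by (auto simp: phase_inv_def)
  ultimately show ?thesis
    using zn(1) sz(1) unfolding phase_inv_def by (intro conjI allI impI) simp_all
qed

section \<open>Correctness of the matching program\<close>

lemma ok_clear_prices:
  assumes "input_ok \<sigma>"
  shows "ok V N clear_prices \<sigma> (\<lambda>\<tau>. frame {''p'', ''y''} {} \<sigma> \<tau> \<and>
    (\<forall>v<n. nats \<tau> ''p'' 0 v = 0))"
  unfolding clear_prices_def
proof (rule ok_for_loop[where n = n and I = "\<lambda>k \<tau>. frame {''p'', ''y''} {} \<sigma> \<tau> \<and>
    (\<forall>v<k. nats \<tau> ''p'' 0 v = 0)"])
  fix k \<tau> assume "frame {''p'', ''y''} {} \<sigma> \<tau> \<and> (\<forall>v<k. nats \<tau> ''p'' 0 v = 0)"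
    "nats \<tau> ''y'' 0 0 = k" "nats \<tau> ''n'' 0 0 = n"
  then show "ok V N (set_elem ''p'' (cell ''y'') (IConst 0)) \<tau> (\<lambda>\<tau>. nats \<tau> ''y'' 0 0 = k \<and>
      nats \<tau> ''n'' 0 0 = n \<and> frame {''p'', ''y''} {} \<sigma> (set_nat ''y'' (Suc k) \<tau>) \<and>
      (\<forall>v<Suc k. nats (set_nat ''y'' (Suc k) \<tau>) ''p'' 0 v = 0))"
    by (intro ok_IAssign) (simp add: upd_row frame_upd)
qed (use assms n_le_N in \<open>simp_all add: input_ok_def frame_upd\<close>)

text \<open>Both outcomes share the first conjunct: for \<open>best = 0\<close> it says that all
  neighbours below \<open>k\<close> cost at least \<open>n\<close>, otherwise that
  \<open>bp\<close>, the price of vertex \<open>best - 1\<close>, is a minimum over them.\<close>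

definition scan_result :: "nat \<Rightarrow> (nat \<Rightarrow> nat) \<Rightarrow> nat \<Rightarrow> nat \<Rightarrow> nat \<Rightarrow> bool" where
  "scan_result x p k best bp \<longleftrightarrow> (\<forall>z<k. A x z \<noteq> 0 \<longrightarrow> bp \<le> p z) \<and>
     (if best = 0 then bp = n
      else best - 1 < n \<and> A x (best - 1) \<noteq> 0 \<and> p (best - 1) = bp \<and> bp < n)"

lemma scan_result_0: "scan_result x p 0 0 n"
  by (simp add: scan_result_def)

lemma scan_result_Suc:
  assumes "scan_result x p k best bp" "k < n"
  shows "A x k \<noteq> 0 \<and> p k < bp \<Longrightarrow> scan_result x p (Suc k) (Suc k) (p k)"
    and "\<not> (A x k \<noteq> 0 \<and> p k < bp) \<Longrightarrow> scan_result x p (Suc k) best bp"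
  using assms by (auto simp: scan_result_def less_Suc_eq split: if_splits)

lemma ok_scan:
  assumes inp: "input_ok \<sigma>" and x: "nats \<sigma> ''x'' 0 0 = x" "x < n"
  shows "ok V N scan \<sigma> (\<lambda>\<tau>. frame {''best'', ''bp'', ''y''} {} \<sigma> \<tau> \<and>
    scan_result x (nats \<sigma> ''p'' 0) n (nats \<tau> ''best'' 0 0) (nats \<tau> ''bp'' 0 0))"
proof -
  let ?K = "frame {''best'', ''bp'', ''y''} {} \<sigma>"
  let ?R = "\<lambda>k \<tau>. scan_result x (nats \<sigma> ''p'' 0) k (nats \<tau> ''best'' 0 0) (nats \<tau> ''bp'' 0 0)"
  show ?thesis
    unfolding scan_def
  proof (intro ok_Seq ok_IAssign, rule ok_for_loop[where n = n and I = "\<lambda>k \<tau>. ?K \<tau> \<and> ?R k \<tau>"])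
    fix k \<tau> assume I: "?K \<tau> \<and> ?R k \<tau>" and k: "k < n" "nats \<tau> ''y'' 0 0 = k" "nats \<tau> ''n'' 0 0 = n"
    have eq: "nats \<tau> ''x'' 0 0 = x" "nats \<tau> ''p'' 0 = nats \<sigma> ''p'' 0" "reals \<tau> ''M'' x k = A x k"
      using frameD[OF conjunct1[OF I]] x inp k by (simp_all add: input_ok_def)
    note R = scan_result_Suc[OF conjunct2[OF I] k(1)]
    have L: "A x k \<in> V" "0 \<in> V" using L_A(1)[THEN L0_V, of x k] L_const[THEN L0_V] x k by auto
    show "ok V N (IfElse (Conj (Neg (REq (RCell ''M'' (cell ''x'') (cell ''y'')) (RConst 0)))
            (ILess (elem ''p'' (cell ''y'')) (cell ''bp'')))
         (Seq (set_cell ''best'' (IAdd (cell ''y'') (IConst 1)))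
              (set_cell ''bp'' (elem ''p'' (cell ''y'')))) Skip) \<tau>
       (\<lambda>\<tau>. nats \<tau> ''y'' 0 0 = k \<and> nats \<tau> ''n'' 0 0 = n \<and>
          ?K (set_nat ''y'' (Suc k) \<tau>) \<and> ?R (Suc k) (set_nat ''y'' (Suc k) \<tau>))"
      using I R L by (intro ok_IfElse ok_Seq ok_IAssign ok_Skip)
        (simp_all add: upd_row frame_upd k eq)
  qed (use inp n_le_N in \<open>simp_all add: input_ok_def upd_row frame_upd scan_result_0\<close>)
qed

text \<open>A failure is final: one unsuccessful root already excludes every supported permutation,
  so the rejecting case does not refer to \<open>r\<close> or \<open>mu\<close>.\<close>

definition phase_post :: "nat \<Rightarrow> nat \<Rightarrow> (nat \<Rightarrow> nat) \<Rightarrow> bool" where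
  "phase_post r fail mu \<longleftrightarrow>
     (if fail = 0 then matching mu \<and> (\<forall>v<r. mu v \<noteq> 0) else fail = 1 \<and> no_perm)"

lemma ok_bid:
  assumes x: "nats \<sigma> ''x'' 0 0 = x" and best: "nats \<sigma> ''best'' 0 0 = Suc y"
    and act: "nats \<sigma> ''act'' 0 0 = 1"
    and mu: "mu = nats \<sigma> ''mu'' 0" and p: "p = nats \<sigma> ''p'' 0" and xy: "x \<noteq> y"
  shows "ok V N bid \<sigma> (\<lambda>\<tau>. frame {''y'', ''z'', ''mu'', ''p'', ''act'', ''x''} {} \<sigma> \<tau> \<and>
    nats \<tau> ''p'' 0 = p(y := Suc (p y)) \<and>
    (case mu y of
       0 \<Rightarrow> nats \<tau> ''act'' 0 0 = 0 \<and> nats \<tau> ''mu'' 0 = mu(x := Suc y, y := Suc x)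
     | Suc z \<Rightarrow> nats \<tau> ''act'' 0 0 = 1 \<and> nats \<tau> ''x'' 0 0 = z \<and>
         nats \<tau> ''mu'' 0 = mu(x := Suc y, y := Suc x, z := 0)))"
  unfolding bid_def
  apply (rule ok_Seq, rule ok_IAssign, simp add: upd_row best)
  apply (rule ok_Seq, rule ok_IAssign, simp add: upd_row mu[symmetric])
  apply (rule ok_Seq, rule ok_IAssign, simp add: upd_row mu[symmetric] x best)
  apply (rule ok_Seq, rule ok_IAssign, simp add: upd_row mu[symmetric] x)
  apply (rule ok_Seq, rule ok_IAssign, simp add: upd_row p[symmetric])
  apply (cases "mu y")
   apply (rule ok_IfElse, simp, rule ok_IAssign)
    apply (simp_all add: upd_row frame_upd mu[symmetric] p[symmetric] xy)
  apply (rule ok_IfElse, simp, simp add: upd_row)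
  apply (rule ok_Seq, rule ok_IAssign, simp add: upd_row)
  apply (rule ok_IAssign)
  apply (simp add: upd_row frame_upd mu[symmetric] p[symmetric] act)
  done

lemma ok_phase:
  assumes inp: "input_ok \<sigma>" and r: "nats \<sigma> ''r'' 0 0 = r" "r < n"
    and fail: "nats \<sigma> ''fail'' 0 0 = 0"
    and mat: "matching (nats \<sigma> ''mu'' 0)" and free: "nats \<sigma> ''mu'' 0 r = 0"
    and prev: "\<And>v. v < r \<Longrightarrow> nats \<sigma> ''mu'' 0 v \<noteq> 0"
  shows "ok V N phase \<sigma> (\<lambda>\<tau>.
    frame {''y'', ''z'', ''mu'', ''p'', ''act'', ''x'', ''best'', ''bp'', ''fail''} {} \<sigma> \<tau> \<and>
    phase_post (Suc r) (nats \<tau> ''fail'' 0 0) (nats \<tau> ''mu'' 0))"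
proof -
  let ?S = "{''y'', ''z'', ''mu'', ''p'', ''act'', ''x'', ''best'', ''bp'', ''fail''}"
  let ?post = "\<lambda>\<tau>. phase_post (Suc r) (nats \<tau> ''fail'' 0 0) (nats \<tau> ''mu'' 0)"
  let ?P = "\<lambda>\<tau>. phase_inv r (nats \<tau> ''mu'' 0) (nats \<tau> ''p'' 0) (nats \<tau> ''x'' 0 0)"
  \<comment> \<open>The flag \<open>act\<close> separates two modes: while it is 1 the auction is
    running, and afterwards the result of the phase already holds.\<close>
  let ?I = "\<lambda>\<tau>. frame ?S {} \<sigma> \<tau> \<and>
    (nats \<tau> ''act'' 0 0 = 1 \<longrightarrow> nats \<tau> ''fail'' 0 0 = 0 \<and> ?P \<tau>) \<and>
    (nats \<tau> ''act'' 0 0 \<noteq> 1 \<longrightarrow> ?post \<tau>)"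
  \<comment> \<open>Every bid raises the sum of the prices, at most \<open>n * n\<close>, by one.
    The extra 1 keeps the measure positive while the auction runs, so that stopping it also counts
    as progress.\<close>
  let ?m = "\<lambda>\<tau>. if nats \<tau> ''act'' 0 0 = 1 then n * n + 1 - (\<Sum>v<n. nats \<tau> ''p'' 0 v) else 0"
  have init: "?I (set_nat ''act'' 1 (set_nat ''x'' r \<tau>))"
    if "frame {''p'', ''y''} {} \<sigma> \<tau> \<and> (\<forall>v<n. nats \<tau> ''p'' 0 v = 0)" for \<tau>
  proof -
    have k: "frame {''p'', ''y''} {} \<sigma> \<tau>" and p0: "\<forall>v<n. nats \<tau> ''p'' 0 v = 0" using that by auto
    have kS: "frame ?S {} \<sigma> \<tau>" by (rule frame_trans[OF k frame_refl[of "{}" "{}"]]) auto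
    have "phase_inv r (nats \<sigma> ''mu'' 0) (nats \<tau> ''p'' 0) r"
      using mat r(2) free prev p0 by (auto simp: phase_inv_def order_le_less)
    then show ?thesis using kS frameD(1)[OF k] fail by (simp add: upd_row frame_upd)
  qed
  have round: "ok V N (Seq scan (IfElse (IEq (cell ''best'') (IConst 0))
      (Seq (set_cell ''fail'' (IConst 1)) (set_cell ''act'' (IConst 0))) bid)) \<tau>
      (\<lambda>\<upsilon>. ?I \<upsilon> \<and> ?m \<upsilon> < ?m \<tau>)"
    if I: "?I \<tau>" and act: "nats \<tau> ''act'' 0 0 = 1" for \<tau>
  proof -
    define mu p x where "mu = nats \<tau> ''mu'' 0" "p = nats \<tau> ''p'' 0" "x = nats \<tau> ''x'' 0 0"
    note defs = this
    have k: "frame ?S {} \<sigma> \<tau>" and f0: "nats \<tau> ''fail'' 0 0 = 0" and inv: "phase_inv r mu p x"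
      using I act by (simp_all add: defs)
    have inp': "input_ok \<tau>" using inp frameD[OF k] by (simp add: input_ok_def)
    have xn: "x < n" using inv by (simp add: phase_inv_def)
    have pn: "p v \<le> n" if "v < n" for v using inv that by (simp add: phase_inv_def)
    have sum_p: "(\<Sum>v<n. p v) \<le> n * n" using sum_mono[of "{..<n}" p "\<lambda>_. n"] pn by simp
    show ?thesis
    proof (rule ok_Seq, rule ok_conseq[OF ok_scan[OF inp', of x]], goal_cases)
      case (3 \<upsilon>)
      then have k': "frame {''best'', ''bp'', ''y''} {} \<tau> \<upsilon>"
        and res: "scan_result x p n (nats \<upsilon> ''best'' 0 0) (nats \<upsilon> ''bp'' 0 0)" by (simp_all add: defs)
      note eq = frameD(1)[OF k']
      have kS: "frame ?S {} \<sigma> \<upsilon>" by (rule frame_trans[OF k k']) auto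
      show ?case
      proof (cases "nats \<upsilon> ''best'' 0 0")
        case 0
        then have no_perm
          using res by (intro phase_inv_no_perm[OF inv]) (auto simp: scan_result_def)
        then show ?thesis
          using 0 kS act sum_p by (intro ok_IfElse ok_Seq ok_IAssign)
            (simp_all add: upd_row frame_upd defs phase_post_def)
      next
        case (Suc y)
        then have y: "y < n" "A x y \<noteq> 0" "p y < n" "\<And>z. z < n \<Longrightarrow> A x z \<noteq> 0 \<Longrightarrow> p y \<le> p z"
          using res by (auto simp: scan_result_def)
        have xy: "x \<noteq> y" using A_side[OF xn y(1,2)] by auto
        have "sum p {..<n} = p y + sum p ({..<n} - {y})" using y(1) by (simp add: sum.remove)
        moreover have "sum (p(y := Suc (p y))) {..<n} = Suc (p y) + sum p ({..<n} - {y})"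
          using y(1) by (simp add: sum.remove)
        ultimately have sum': "sum (p(y := Suc (p y))) {..<n} = Suc (sum p {..<n})" by simp
        have "ok V N bid \<upsilon> (\<lambda>\<upsilon>'. ?I \<upsilon>' \<and> ?m \<upsilon>' < ?m \<tau>)"
        proof (rule ok_conseq[OF ok_bid[of \<upsilon> x y mu p]], goal_cases)
          case (7 \<upsilon>')
          then have k2: "frame {''y'', ''z'', ''mu'', ''p'', ''act'', ''x''} {} \<upsilon> \<upsilon>'"
            and p': "nats \<upsilon>' ''p'' 0 = p(y := Suc (p y))" by auto
          have kS': "frame ?S {} \<sigma> \<upsilon>'" by (rule frame_trans[OF kS k2]) auto
          have f': "nats \<upsilon>' ''fail'' 0 0 = 0" using frameD(1)[OF k2] eq f0 by simp
          show ?case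
          proof (cases "mu y")
            case 0
            then have *: "nats \<upsilon>' ''act'' 0 0 = 0"
              "nats \<upsilon>' ''mu'' 0 = mu(x := Suc y, y := Suc x)" using 7 by auto
            have "\<forall>v<Suc r. (mu(x := Suc y, y := Suc x)) v \<noteq> 0"
              using bid_free(2)[OF inv y(1,2) 0] by (simp only: less_Suc_eq_le) blast
            with * show ?thesis
              using bid_free(1)[OF inv y(1,2) 0] kS' f' act sum_p
              by (simp del: fun_upd_apply add: phase_post_def) (simp add: defs)
          next
            case (Suc z)
            then have "nats \<upsilon>' ''act'' 0 0 = 1" "nats \<upsilon>' ''x'' 0 0 = z"
              "nats \<upsilon>' ''mu'' 0 = mu(x := Suc y, y := Suc x, z := 0)" using 7 by auto
            then show ?thesis
              using bid_evict[OF inv y Suc] kS' f' act sum_p sum'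
              by (simp del: fun_upd_apply add: p') (simp add: defs)
          qed
        qed (use Suc eq act xy in \<open>simp_all add: defs\<close>)
        then show ?thesis using Suc by (intro ok_IfElse) simp_all
      qed
    qed (use xn in \<open>simp_all add: defs\<close>)
  qed
  have loop: "ok V N (While (IEq (cell ''act'') (IConst 1))
       (Seq scan
         (IfElse (IEq (cell ''best'') (IConst 0))
           (Seq (set_cell ''fail'' (IConst 1)) (set_cell ''act'' (IConst 0)))
           bid))) \<tau> (\<lambda>\<tau>. frame ?S {} \<sigma> \<tau> \<and> ?post \<tau>)" if "?I \<tau>" for \<tau>
  proof (rule ok_While[where I = ?I and m = ?m], rule that)
    have "?m \<tau> \<le> n * n + 1" by simp
    also have "\<dots> \<le> N" by (simp add: power2_eq_square)
    finally show "?m \<tau> \<le> N" .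
  next
    fix \<tau> assume "?I \<tau>" "tval \<tau> (IEq (cell ''act'') (IConst 1))"
    then show "ok V N (Seq scan (IfElse (IEq (cell ''best'') (IConst 0))
      (Seq (set_cell ''fail'' (IConst 1)) (set_cell ''act'' (IConst 0))) bid)) \<tau>
      (\<lambda>\<upsilon>. ?I \<upsilon> \<and> ?m \<upsilon> < ?m \<tau>)" by (intro round) simp_all
  next
    fix \<tau> assume "?I \<tau>" "\<not> tval \<tau> (IEq (cell ''act'') (IConst 1))"
    then show "frame ?S {} \<sigma> \<tau> \<and> ?post \<tau>" by simp
  qed simp
  show ?thesis
    unfolding phase_def
  proof (rule ok_Seq, rule ok_conseq[OF ok_clear_prices[OF inp]], intro ok_Seq ok_IAssign, goal_cases)
    case (1 \<tau>)
    then have "nats \<tau> ''r'' 0 0 = r" using frameD(1)[of "{''p'', ''y''}" "{}" \<sigma> \<tau>] r by simp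
    with loop[OF init[OF 1]] show ?case by simp
  qed
qed

lemma ok_find_matching:
  assumes inp: "input_ok \<sigma>" and zero: "nats \<sigma> ''fail'' 0 0 = 0" "\<And>v. nats \<sigma> ''mu'' 0 v = 0"
  shows "ok V N find_matching \<sigma> (\<lambda>\<tau>. input_ok \<tau> \<and> nats \<tau> ''answer'' = nats \<sigma> ''answer'' \<and>
    phase_post n (nats \<tau> ''fail'' 0 0) (nats \<tau> ''mu'' 0))"
proof -
  let ?S = "{''y'', ''z'', ''mu'', ''p'', ''act'', ''x'', ''best'', ''bp'', ''fail'', ''r''}"
  let ?T = "{''y'', ''z'', ''mu'', ''p'', ''act'', ''x'', ''best'', ''bp'', ''fail''}"
  let ?post = "\<lambda>r \<tau>. phase_post r (nats \<tau> ''fail'' 0 0) (nats \<tau> ''mu'' 0)"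
  show ?thesis
    unfolding find_matching_def
  proof (rule ok_for_loop[where n = n and I = "\<lambda>r \<tau>. frame ?S {} \<sigma> \<tau> \<and> ?post r \<tau>"])
    fix r \<tau> assume I: "frame ?S {} \<sigma> \<tau> \<and> ?post r \<tau>" and r: "r < n" "nats \<tau> ''r'' 0 0 = r"
      and n: "nats \<tau> ''n'' 0 0 = n"
    have k: "frame ?S {} \<sigma> \<tau>" and post: "?post r \<tau>" using I by auto
    have inp': "input_ok \<tau>" using inp frameD[OF k] by (simp add: input_ok_def)
    let ?Q = "\<lambda>\<tau>. nats \<tau> ''r'' 0 0 = r \<and> nats \<tau> ''n'' 0 0 = n \<and>
      frame ?S {} \<sigma> (set_nat ''r'' (Suc r) \<tau>) \<and> ?post (Suc r) (set_nat ''r'' (Suc r) \<tau>)"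
    show "ok V N (IfElse (Conj (IEq (cell ''fail'') (IConst 0))
        (IEq (elem ''mu'' (cell ''r'')) (IConst 0))) phase Skip) \<tau> ?Q"
    proof (rule ok_IfElse, goal_cases)
      case 2
      then have f: "nats \<tau> ''fail'' 0 0 = 0" "nats \<tau> ''mu'' 0 r = 0" using r by auto
      show ?case
      proof (rule ok_conseq[OF ok_phase[OF inp' r(2,1) f(1) _ f(2)]], goal_cases)
        case (3 \<upsilon>)
        then have k': "frame ?T {} \<tau> \<upsilon>" by blast
        have "frame ?S {} \<sigma> \<upsilon>" by (rule frame_trans[OF k k']) auto
        with 3 show ?case using frameD(1)[OF k'] r n by (simp add: upd_row frame_upd)
      qed (use post f in \<open>simp_all add: phase_post_def\<close>)
    next
      case 3
      then have "?post (Suc r) \<tau>" using post r by (auto simp: phase_post_def less_Suc_eq)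
      then show ?case using k r n by (intro ok_Skip) (simp add: upd_row frame_upd)
    qed simp
  next
    show "frame ?S {} \<sigma> (set_nat ''r'' 0 \<sigma>) \<and> ?post 0 (set_nat ''r'' 0 \<sigma>)"
      using zero by (simp add: upd_row frame_upd matching_def phase_post_def)
  next
    fix \<tau> assume I: "frame ?S {} \<sigma> \<tau> \<and> ?post n \<tau>"
    then have "input_ok \<tau>" using inp frameD[of ?S "{}" \<sigma> \<tau>] by (simp add: input_ok_def)
    moreover have "nats \<tau> ''answer'' = nats \<sigma> ''answer''" using I frameD(1)[of ?S "{}" \<sigma> \<tau>] by simp
    ultimately show "input_ok \<tau> \<and> nats \<tau> ''answer'' = nats \<sigma> ''answer'' \<and>
      ?post n \<tau>" using I by blast
  qed (use inp n_le_N in \<open>simp_all add: input_ok_def\<close>)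
qed

end

section \<open>Signing the remaining edges\<close>

abbreviation rcell :: "string \<Rightarrow> rexp" where
  "rcell a \<equiv> RCell a (IConst 0) (IConst 0)"

abbreviation set_rcell :: "string \<Rightarrow> rexp \<Rightarrow> com" where
  "set_rcell a e \<equiv> RAssign a (IConst 0) (IConst 0) e"

text \<open>The matrix of the matching has one nonzero entry per row, so its inverse is known in
  closed form: reciprocals at the transposed positions, which by symmetry are the same
  positions.\<close>

definition init_signing :: com where
  "init_signing = for_loop ''u'' ''n'' (for_loop ''v'' ''n''
     (Seq (RAssign ''s'' (cell ''u'') (cell ''v'') (RConst 1))
       (IfElse (IEq (elem ''mu'' (cell ''v'')) (IAdd (cell ''u'') (IConst 1)))
         (RAssign ''B'' (cell ''u'') (cell ''v'')
            (RDiv (RConst 1) (RCell ''M'' (cell ''u'') (cell ''v''))))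
         (RAssign ''B'' (cell ''u'') (cell ''v'') (RConst 0)))))"

definition set_sign :: "int \<Rightarrow> com" where
  "set_sign e = Seq (RAssign ''s'' (cell ''u'') (cell ''v'') (RConst e))
     (Seq (RAssign ''s'' (cell ''v'') (cell ''u'') (RConst e))
     (set_rcell ''a'' (RMul (RConst e) (RCell ''M'' (cell ''u'') (cell ''v'')))))"

definition choose_sign :: com where
  "choose_sign = Seq
     (IfElse (REq (RAdd (RConst 1) (RMul (RCell ''M'' (cell ''u'') (cell ''v''))
                                         (RCell ''B'' (cell ''u'') (cell ''v'')))) (RConst 0))
        (set_sign (- 1)) (set_sign 1))
     (set_rcell ''f'' (RDiv (rcell ''a'')
        (RAdd (RConst 1) (RMul (rcell ''a'') (RCell ''B'' (cell ''u'') (cell ''v''))))))"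

text \<open>The update overwrites \<open>B\<close> in place while still needing its old rows
  \<open>u\<close> and \<open>v\<close>, hence the copies. As \<open>B\<close> is symmetric, they
  also serve as the old columns.\<close>

definition save_rows :: com where
  "save_rows = for_loop ''j'' ''n''
     (Seq (RAssign ''P'' (IConst 0) (cell ''j'') (RCell ''B'' (cell ''u'') (cell ''j'')))
          (RAssign ''Q'' (IConst 0) (cell ''j'') (RCell ''B'' (cell ''v'') (cell ''j''))))"

definition update_inverse :: com where
  "update_inverse = for_loop ''i'' ''n'' (for_loop ''j'' ''n''
     (RAssign ''B'' (cell ''i'') (cell ''j'')
        (RSub (RCell ''B'' (cell ''i'') (cell ''j''))
          (RMul (rcell ''f'')
            (RAdd (RMul (RCell ''P'' (IConst 0) (cell ''i'')) (RCell ''Q'' (IConst 0) (cell ''j'')))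
                  (RMul (RCell ''Q'' (IConst 0) (cell ''i'')) (RCell ''P'' (IConst 0) (cell ''j''))))))))"

text \<open>With \<open>v\<close> below \<open>u\<close> every unordered pair is met once and the
  diagonal never. A pair with \<open>M[u,v] = 0\<close> is harmless: then \<open>a\<close> and
  \<open>f\<close> are 0 and \<open>B\<close> does not change.\<close>

definition find_signing :: com where
  "find_signing = Seq init_signing
     (for_loop ''u'' ''n'' (for_loop ''v'' ''u''
        (IfElse (IEq (elem ''mu'' (cell ''v'')) (IAdd (cell ''u'') (IConst 1)))
           Skip (Seq choose_sign (Seq save_rows update_inverse)))))"

definition signing_algorithm :: com where
  "signing_algorithm = Seq find_matching
     (IfElse (IEq (cell ''fail'') (IConst 0))
        (Seq find_signing (set_cell ''answer'' (IConst 1))) Skip)"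

section \<open>The inverse while edges are added\<close>

context bipartite_input
begin

text \<open>\<open>D\<close> marks the positions switched on so far. The sum says that
  \<open>B\<close> is a right inverse of \<open>M(s)\<close> masked by \<open>D\<close>, whereas
  \<open>s\<close> is a full symmetric signing from the start.\<close>

definition sign_inv ::
  "(nat \<Rightarrow> nat \<Rightarrow> bool) \<Rightarrow> (nat \<Rightarrow> nat \<Rightarrow> real) \<Rightarrow> (nat \<Rightarrow> nat \<Rightarrow> real) \<Rightarrow> bool" where
  "sign_inv D s B \<longleftrightarrow> (\<forall>i<n. \<forall>j<n.
     s i j \<in> {1, - 1} \<and> s i j = s j i \<and> B i j = B j i \<and> (side i = side j \<longrightarrow> B i j = 0) \<and>
     (\<Sum>k<n. of_bool (D i k) * A i k * s i k * B k j) = of_bool (i = j))"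

lemma sign_invD:
  assumes "sign_inv D s B" "i < n" "j < n"
  shows "s i j \<in> {1, - 1}" "s i j = s j i" "B i j = B j i" "side i = side j \<Longrightarrow> B i j = 0"
    "(\<Sum>k<n. of_bool (D i k) * A i k * s i k * B k j) = of_bool (i = j)"
  using assms unfolding sign_inv_def by blast+

text \<open>\<open>D\<close> and \<open>D'\<close> are compared on the support only, because
  elsewhere the summands vanish; this is what finally allows the mask to become constantly
  true.\<close>

lemma sign_inv_cong:
  assumes "sign_inv D s B" "\<And>i j. i < n \<Longrightarrow> j < n \<Longrightarrow> s' i j = s i j"
    "\<And>i j. i < n \<Longrightarrow> j < n \<Longrightarrow> B' i j = B i j"
    "\<And>i j. i < n \<Longrightarrow> j < n \<Longrightarrow> A i j \<noteq> 0 \<Longrightarrow> D' i j = D i j"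
  shows "sign_inv D' s' B'"
  unfolding sign_inv_def
proof (intro allI impI)
  fix i j assume ij: "i < n" "j < n"
  have "(\<Sum>k<n. of_bool (D' i k) * A i k * s' i k * B' k j) =
      (\<Sum>k<n. of_bool (D i k) * A i k * s i k * B k j)"
    using assms(2-4) ij by (intro sum.cong refl) (auto simp: of_bool_def)
  then show "s' i j \<in> {1, - 1} \<and> s' i j = s' j i \<and> B' i j = B' j i \<and>
      (side i = side j \<longrightarrow> B' i j = 0) \<and>
      (\<Sum>k<n. of_bool (D' i k) * A i k * s' i k * B' k j) = of_bool (i = j)"
    using sign_invD[OF assms(1) ij] assms(2,3) ij by auto
qed

text \<open>However many updates have produced \<open>B\<close>, it is the inverse of a masked
  signing of \<open>A\<close> and therefore sits at the bottom level: depth does not build up from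
  one update to the next.\<close>

lemma sign_inv_L:
  assumes "sign_inv D s B" "i < n" "j < n"
  shows "B i j \<in> L 0"
proof (rule L_inverse[where G = "\<lambda>i k. of_bool (D i k) * A i k * s i k"])
  show "of_bool (D i j) * A i j * s i j \<in> {0, A i j, - A i j}" if "i < n" "j < n" for i j
    using sign_invD(1)[OF assms(1) that] by auto
qed (use sign_invD(5)[OF assms(1)] assms in auto)

text \<open>Row \<open>i\<close> of the masked matrix has its only nonzero entry at the partner
  \<open>m\<close> of \<open>i\<close>, so the sum collapses to the term
  \<open>k = m\<close>.\<close>

lemma sign_inv_init:
  assumes mat: "matching mu" and all: "\<And>v. v < n \<Longrightarrow> mu v \<noteq> 0"
  shows "sign_inv (\<lambda>i j. mu j = Suc i) (\<lambda>i j. 1) (\<lambda>i j. if mu j = Suc i then 1 / A i j else 0)"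
  unfolding sign_inv_def
proof (intro allI impI)
  fix i j assume ij: "i < n" "j < n"
  have mm: "\<And>i j. i < n \<Longrightarrow> mu i = Suc j \<Longrightarrow> j < n \<and> mu j = Suc i \<and> A i j \<noteq> 0"
    using mat unfolding matching_def by blast
  then have iff: "mu j = Suc i \<longleftrightarrow> mu i = Suc j" if "i < n" "j < n" for i j using that by metis
  obtain m where m: "mu i = Suc m" using all[OF ij(1)] by (cases "mu i") auto
  have mn: "m < n" "mu m = Suc i" "A i m \<noteq> 0" using mm[OF ij(1) m] by auto
  have uniq: "mu k = Suc i \<longleftrightarrow> k = m" if "k < n" for k using iff[OF ij(1) that] m by auto
  have "(\<Sum>k<n. of_bool (mu k = Suc i) * A i k * 1 * (if mu j = Suc k then 1 / A k j else 0)) =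
      (\<Sum>k<n. if k = m then A i m * (if mu j = Suc m then 1 / A m j else 0) else 0)"
    by (intro sum.cong refl) (use uniq in auto)
  also have "\<dots> = A i m * (if mu j = Suc m then 1 / A m j else 0)" using mn by simp
  also have "mu j = Suc m \<longleftrightarrow> j = i" using iff[OF mn(1) ij(2)] mn(2) by auto
  also have "A i m * (if j = i then 1 / A m j else 0) = of_bool (i = j)"
    using mn(3) A_sym[OF ij(1) mn(1)] by auto
  finally show "(1::real) \<in> {1, - 1} \<and> (1::real) = 1 \<and>
     (if mu j = Suc i then 1 / A i j else 0) = (if mu i = Suc j then 1 / A j i else 0) \<and>
     (side i = side j \<longrightarrow> (if mu j = Suc i then 1 / A i j else 0) = 0) \<and>
     (\<Sum>k<n. of_bool (mu k = Suc i) * A i k * 1 * (if mu j = Suc k then 1 / A k j else 0)) =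
       of_bool (i = j)"
    using iff[OF ij] A_sym[OF ij] A_side[OF ij] by auto
qed

text \<open>
  Two Sherman--Morrison steps; they do not interact because \<open>B u u = B v v = 0\<close>.
\<close>

lemma sign_inv_update:
  assumes inv: "sign_inv D s B" and uv: "u < n" "v < n" "u \<noteq> v" "\<not> D u v" "\<not> D v u"
    and e: "e \<in> {1, - 1}" and a: "a = e * A u v" and nz: "1 + a * B u v \<noteq> 0"
    and f: "f = a / (1 + a * B u v)"
    and s': "\<And>i j. i < n \<Longrightarrow> j < n \<Longrightarrow>
      s' i j = (if i = u \<and> j = v \<or> i = v \<and> j = u then e else s i j)"
    and B': "\<And>i j. i < n \<Longrightarrow> j < n \<Longrightarrow> B' i j = B i j - f * (B u i * B v j + B v i * B u j)"
    and D': "\<And>i j. i < n \<Longrightarrow> j < n \<Longrightarrow>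
      D' i j \<longleftrightarrow> D i j \<or> i = u \<and> j = v \<or> i = v \<and> j = u"
  shows "sign_inv D' s' B'"
  unfolding sign_inv_def
proof (intro allI impI)
  fix i j assume ij: "i < n" "j < n"
  note inv_ij = sign_invD[OF inv]
  define G where "G i k = of_bool (D i k) * A i k * s i k" for i k
  have GB: "(\<Sum>k<n. G i k * B k j) = of_bool (i = j)" if "j < n" for j
    using inv_ij(5)[OF ij(1) that] by (simp add: G_def)
  have diag: "B u u = 0" "B v v = 0" using inv_ij(4) uv by auto
  have sym: "B v u = B u v" using inv_ij(3) uv by auto
  \<comment> \<open>Both positions were off in \<open>D\<close>, so \<open>G\<close> is 0 there and
    the new entries enter as pure summands.\<close>
  have G': "of_bool (D' i k) * A i k * s' i k =
      G i k + (if k = v then a * of_bool (i = u) else 0) + (if k = u then a * of_bool (i = v) else 0)"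
    if "k < n" for k
    using that ij uv e D' s' A_sym[OF uv(1,2)] unfolding G_def a
    by (cases "i = u \<and> k = v \<or> i = v \<and> k = u") (auto simp: mult.commute)
  \<comment> \<open>By symmetry the rows \<open>u\<close> and \<open>v\<close> of \<open>B\<close>
    are read as columns, which multiplication by \<open>G\<close> turns into unit vectors.\<close>
  have sum1: "(\<Sum>k<n. G i k * B' k j) =
      of_bool (i = j) - f * (of_bool (i = u) * B v j + of_bool (i = v) * B u j)"
  proof -
    have "(\<Sum>k<n. G i k * B' k j) =
      (\<Sum>k<n. G i k * B k j - f * (G i k * B k u * B v j + G i k * B k v * B u j))"
    proof (intro sum.cong refl)
      fix k assume "k \<in> {..<n}"
      then have k: "k < n" by simp
      show "G i k * B' k j = G i k * B k j - f * (G i k * B k u * B v j + G i k * B k v * B u j)"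
        unfolding B'[OF k ij(2)] inv_ij(3)[OF uv(1) k] inv_ij(3)[OF uv(2) k]
        by (simp add: algebra_simps)
    qed
    also have "\<dots> = (\<Sum>k<n. G i k * B k j) -
        f * ((\<Sum>k<n. G i k * B k u) * B v j + (\<Sum>k<n. G i k * B k v) * B u j)"
      by (simp add: sum_subtractf sum.distrib sum_distrib_left[symmetric] sum_distrib_right[symmetric])
    finally show ?thesis using GB ij uv by simp
  qed
  \<comment> \<open>This equation determines \<open>f\<close>: the contribution of the two new
    entries has to cancel the correction with factor \<open>f\<close> in
    \<open>sum1\<close>.\<close>
  have af: "a * (1 - f * B u v) = f" using nz f by (simp add: field_simps)
  have "a * B' v j = a * (1 - f * B u v) * B v j" "a * B' u j = a * (1 - f * B u v) * B u j"
    unfolding B'[OF uv(2) ij(2)] B'[OF uv(1) ij(2)] by (simp_all add: diag sym algebra_simps)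
  then have row: "a * B' v j = f * B v j" "a * B' u j = f * B u j" by (simp_all only: af)
  have "(\<Sum>k<n. of_bool (D' i k) * A i k * s' i k * B' k j) = (\<Sum>k<n. G i k * B' k j +
     (if k = v then a * of_bool (i = u) * B' v j else 0) + (if k = u then a * of_bool (i = v) * B' u j else 0))"
    using G' by (intro sum.cong refl) (auto simp: algebra_simps)
  also have "\<dots> = (\<Sum>k<n. G i k * B' k j) + a * of_bool (i = u) * B' v j + a * of_bool (i = v) * B' u j"
    using uv by (simp add: sum.distrib)
  also have "\<dots> = of_bool (i = j)"
    unfolding sum1 using row uv(3) by (cases "i = u"; cases "i = v") simp_all
  finally have sum: "(\<Sum>k<n. of_bool (D' i k) * A i k * s' i k * B' k j) = of_bool (i = j)" .
  \<comment> \<open>If \<open>u\<close> and \<open>v\<close> lie on one side, the update is void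
    since \<open>A u v = 0\<close>. Otherwise \<open>i\<close> and \<open>j\<close> both lie on the
    side of \<open>u\<close> or both on that of \<open>v\<close>, and each product has a vanishing
    factor.\<close>
  have "B' i j = 0" if "side i = side j"
  proof (cases "side u = side v")
    case True
    then have "A u v = 0" using A_side[OF uv(1,2)] by auto
    then show ?thesis using that ij B' inv_ij(4) by (simp add: f a)
  next
    case False
    then have "B u i * B v j = 0" "B v i * B u j = 0"
      using that inv_ij(4) uv ij by (metis mult_eq_0_iff)+
    then show ?thesis unfolding B'[OF ij] using inv_ij(4)[OF ij that] by (simp only: mult_zero_right) simp
  qed
  moreover have "B' i j = B' j i"
    unfolding B'[OF ij] B'[OF ij(2,1)] using inv_ij(3)[OF ij] by simp
  moreover have "s' i j \<in> {1, - 1}" "s' i j = s' j i" using s' ij e inv_ij(1,2) by auto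
  ultimately show "s' i j \<in> {1, - 1} \<and> s' i j = s' j i \<and> B' i j = B' j i \<and>
      (side i = side j \<longrightarrow> B' i j = 0) \<and>
      (\<Sum>k<n. of_bool (D' i k) * A i k * s' i k * B' k j) = of_bool (i = j)"
    using sum by blast
qed

section \<open>Correctness of the signing program\<close>

lemma input_ok_frame: "input_ok \<sigma> \<Longrightarrow> frame S T \<sigma> \<tau> \<Longrightarrow> ''n'' \<notin> S \<Longrightarrow> ''M'' \<notin> T \<Longrightarrow> input_ok \<tau>"
  by (simp add: input_ok_def frame_def)

lemma ok_init_signing:
  assumes inp: "input_ok \<sigma>" and mu: "mu = nats \<sigma> ''mu'' 0"
    and mat: "matching mu" and all: "\<And>v. v < n \<Longrightarrow> mu v \<noteq> 0"
  shows "ok V N init_signing \<sigma> (\<lambda>\<tau>. frame {''u'', ''v''} {''s'', ''B''} \<sigma> \<tau> \<and>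
    sign_inv (\<lambda>i j. mu j = Suc i) (reals \<tau> ''s'') (reals \<tau> ''B''))"
  unfolding init_signing_def
proof (rule ok_for_loop2[where n = n and m = "\<lambda>_. n" and
      I = "\<lambda>k l \<tau>. frame {''u'', ''v''} {''s'', ''B''} \<sigma> \<tau> \<and>
      (\<forall>i<n. \<forall>j<n. i < k \<or> i = k \<and> j < l \<longrightarrow>
        reals \<tau> ''s'' i j = 1 \<and> reals \<tau> ''B'' i j = (if mu j = Suc i then 1 / A i j else 0))"],
    goal_cases)
  \<comment> \<open>Cases 12, 13 and 14 are the assumptions \<open>step\<close>, \<open>row\<close>
    and \<open>Q\<close> of \<open>ok_for_loop2\<close>.\<close>
  case (12 k l \<tau>)
  have fr: "frame {''u'', ''v''} {''s'', ''B''} \<sigma> \<tau>" using 12(1) by blast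
  have eq: "nats \<tau> ''mu'' 0 = mu" "reals \<tau> ''M'' k l = A k l"
    using frameD[OF fr] inp mu 12(2,3) by (simp_all add: input_ok_def)
  have L: "0 \<in> V" "1 \<in> V" "A k l \<in> V" "1 / A k l \<in> V"
    using L_const L_A(1)[OF 12(2,3)] L_op(4)[of 1 0 "A k l"] by (auto intro: L0_V L_mono[of 1 5])
  show ?case
    apply (rule ok_Seq, rule ok_RAssign)
     apply (simp add: L)
    apply (simp add: 12(4,5))
    apply (rule ok_IfElse)
      apply simp
     apply (rule ok_RAssign)
      apply (simp add: 12(4,5) upd_row eq L)
     apply (use 12(1) in \<open>simp add: 12(4-6) upd_row eq frame_upd less_Suc_eq\<close>)
    apply (rule ok_RAssign)
     apply (simp add: L)
    apply (use 12(1) in \<open>simp add: 12(4-6) upd_row eq frame_upd less_Suc_eq\<close>)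
    done
next
  case (13 k \<tau>)
  then show ?case by (auto simp: less_Suc_eq)
next
  case (14 \<tau>)
  then show ?case by (auto intro: sign_inv_cong[OF sign_inv_init[OF mat all]])
qed (use inp n_le_N in \<open>simp_all add: input_ok_def frame_upd upd_row\<close>)

lemma ok_set_sign:
  assumes inp: "input_ok \<sigma>" and uv: "nats \<sigma> ''u'' 0 0 = u" "nats \<sigma> ''v'' 0 0 = v" "u < n" "v < n"
    and e: "e \<in> {1, - 1}"
  shows "ok V N (set_sign e) \<sigma> (\<lambda>\<tau>. frame {} {''s'', ''a''} \<sigma> \<tau> \<and>
    reals \<tau> ''a'' 0 0 = of_int e * A u v \<and>
    (\<forall>i j. reals \<tau> ''s'' i j =
       (if i = u \<and> j = v \<or> i = v \<and> j = u then of_int e else reals \<sigma> ''s'' i j)))"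
proof -
  have L: "of_int e \<in> V" "A u v \<in> V" "of_int e * A u v \<in> V"
    using L_const L_A(1)[OF uv(3,4)] L_op(3)[of "of_int e" 0 "A u v"] e
    by (auto intro: L0_V L_mono[of 1 5])
  have M: "reals \<sigma> ''M'' u v = A u v" using inp uv by (simp add: input_ok_def)
  show ?thesis
    unfolding set_sign_def
    apply (rule ok_Seq, rule ok_RAssign, simp add: L, simp add: uv)
    apply (rule ok_Seq, rule ok_RAssign, simp add: L, simp add: uv)
    apply (rule ok_RAssign)
     apply (simp add: uv upd_row M L)
    apply (simp add: uv upd_row M frame_upd)
    done
qed

lemma ok_choose_sign:
  assumes inp: "input_ok \<sigma>" and uv: "nats \<sigma> ''u'' 0 0 = u" "nats \<sigma> ''v'' 0 0 = v" "u < n" "v < n"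
    and B: "reals \<sigma> ''B'' u v = b" "b \<in> L 0"
  shows "ok V N choose_sign \<sigma> (\<lambda>\<tau>. frame {} {''s'', ''a'', ''f''} \<sigma> \<tau> \<and>
    (\<exists>e\<in>{1, - 1}. 1 + e * A u v * b \<noteq> 0 \<and> reals \<tau> ''f'' 0 0 = e * A u v / (1 + e * A u v * b) \<and>
      (\<forall>i j. reals \<tau> ''s'' i j =
        (if i = u \<and> j = v \<or> i = v \<and> j = u then e else reals \<sigma> ''s'' i j))) \<and>
    reals \<tau> ''f'' 0 0 \<in> L 3)"
proof -
  let ?post = "\<lambda>\<tau>. frame {} {''s'', ''a'', ''f''} \<sigma> \<tau> \<and>
    (\<exists>e\<in>{1, - 1}. 1 + e * A u v * b \<noteq> 0 \<and> reals \<tau> ''f'' 0 0 = e * A u v / (1 + e * A u v * b) \<and>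
      (\<forall>i j. reals \<tau> ''s'' i j =
        (if i = u \<and> j = v \<or> i = v \<and> j = u then e else reals \<sigma> ''s'' i j))) \<and>
    reals \<tau> ''f'' 0 0 \<in> L 3"
  let ?c = "set_rcell ''f'' (RDiv (rcell ''a'')
      (RAdd (RConst 1) (RMul (rcell ''a'') (RCell ''B'' (cell ''u'') (cell ''v'')))))"
  let ?t = "REq (RAdd (RConst 1) (RMul (RCell ''M'' (cell ''u'') (cell ''v''))
      (RCell ''B'' (cell ''u'') (cell ''v'')))) (RConst 0)"
  have M: "reals \<sigma> ''M'' u v = A u v" using inp uv by (simp add: input_ok_def)
  have L: "1 + x * b \<in> L 2" "x * b \<in> L 1" "x / (1 + x * b) \<in> L 3" if "x \<in> L 0" for x
  proof -
    show xb: "x * b \<in> L 1" using L_op(3)[OF that B(2)] by simp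
    show d: "1 + x * b \<in> L 2"
      using L_op(1)[OF L_mono[OF _ L_const(2), of 1] xb] by (simp add: numeral_2_eq_2)
    show "x / (1 + x * b) \<in> L 3"
      using L_op(4)[OF L_mono[OF _ that, of 2] d] by (simp add: numeral_3_eq_3 numeral_2_eq_2)
  qed
  have V: "1 + x * b \<in> V" "x * b \<in> V" "x / (1 + x * b) \<in> V" if "x \<in> L 0" for x
    using L_mono[OF _ L(1)[OF that], of 5] L_mono[OF _ L(2)[OF that], of 5]
      L_mono[OF _ L(3)[OF that], of 5] by simp_all
  have sign: "ok V N (set_sign e) \<sigma> (\<lambda>\<tau>. ok V N ?c \<tau> ?post)"
    if e: "e \<in> {1, - 1}" and nz: "1 + of_int e * A u v * b \<noteq> 0" and eA: "of_int e * A u v \<in> L 0" for e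
  proof (rule ok_conseq[OF ok_set_sign[OF inp uv e]], elim conjE)
    fix \<tau> assume fr: "frame {} {''s'', ''a''} \<sigma> \<tau>" and a: "reals \<tau> ''a'' 0 0 = of_int e * A u v"
      and s: "\<forall>i j. reals \<tau> ''s'' i j =
        (if i = u \<and> j = v \<or> i = v \<and> j = u then of_int e else reals \<sigma> ''s'' i j)"
    have eq: "nats \<tau> ''u'' 0 0 = u" "nats \<tau> ''v'' 0 0 = v" "reals \<tau> ''B'' u v = b"
      using frameD[OF fr] uv B by simp_all
    have fr': "frame {} {''s'', ''a'', ''f''} \<sigma> \<tau>" by (rule frame_trans[OF fr frame_refl[of "{}" "{}"]]) auto
    have "\<exists>e'\<in>{1, - 1}. e' = real_of_int e" using e by auto
    then obtain e' where e': "e' \<in> {1, - 1}" "e' = real_of_int e" by blast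
    show "ok V N ?c \<tau> ?post"
    proof (rule ok_RAssign)
      show "values_in V \<tau> (RDiv (rcell ''a'')
        (RAdd (RConst 1) (RMul (rcell ''a'') (RCell ''B'' (cell ''u'') (cell ''v'')))))"
        using V[OF eA] L0_V[OF eA] L0_V[OF B(2)] L_const[THEN L0_V] by (simp add: eq a)
    qed (use fr' e' s nz L(3)[OF eA] in \<open>auto simp: eq a upd_row frame_upd\<close>)
  qed
  show ?thesis
    unfolding choose_sign_def
  proof (rule ok_Seq, rule ok_IfElse)
    show "test_values_in V \<sigma> ?t"
      using V[OF L_A(1)[OF uv(3,4)]] L0_V[OF L_A(1)[OF uv(3,4)]] L0_V[OF B(2)] L_const[THEN L0_V]
      by (simp add: M uv B(1))
  next
    assume "tval \<sigma> ?t"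
    \<comment> \<open>Hence \<open>A u v * b = - 1\<close>, and the opposite sign makes the
      denominator equal to 2.\<close>
    then have "1 + A u v * b = 0" by (simp add: M uv B(1))
    with sign[of "- 1"] L_A(2)[OF uv(3,4)] show "ok V N (set_sign (- 1)) \<sigma> (\<lambda>\<tau>. ok V N ?c \<tau> ?post)" by simp
  next
    assume "\<not> tval \<sigma> ?t"
    then have "1 + A u v * b \<noteq> 0" by (simp add: M uv B(1))
    with sign[of 1] L_A(1)[OF uv(3,4)] show "ok V N (set_sign 1) \<sigma> (\<lambda>\<tau>. ok V N ?c \<tau> ?post)" by simp
  qed
qed

lemma ok_save_rows:
  assumes inp: "input_ok \<sigma>" and uv: "nats \<sigma> ''u'' 0 0 = u" "nats \<sigma> ''v'' 0 0 = v"
    and B: "\<And>j. j < n \<Longrightarrow> reals \<sigma> ''B'' u j \<in> V" "\<And>j. j < n \<Longrightarrow> reals \<sigma> ''B'' v j \<in> V"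
  shows "ok V N save_rows \<sigma> (\<lambda>\<tau>. frame {''j''} {''P'', ''Q''} \<sigma> \<tau> \<and>
    (\<forall>j<n. reals \<tau> ''P'' 0 j = reals \<sigma> ''B'' u j \<and> reals \<tau> ''Q'' 0 j = reals \<sigma> ''B'' v j))"
  unfolding save_rows_def
proof (rule ok_for_loop[where n = n and I = "\<lambda>k \<tau>. frame {''j''} {''P'', ''Q''} \<sigma> \<tau> \<and>
    (\<forall>j<k. reals \<tau> ''P'' 0 j = reals \<sigma> ''B'' u j \<and> reals \<tau> ''Q'' 0 j = reals \<sigma> ''B'' v j)"],
    goal_cases)
  case (5 k \<tau>)
  then have fr: "frame {''j''} {''P'', ''Q''} \<sigma> \<tau>" by blast
  have eq: "nats \<tau> ''u'' 0 0 = u" "nats \<tau> ''v'' 0 0 = v" "reals \<tau> ''B'' = reals \<sigma> ''B''"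
    using frameD[OF fr] uv by simp_all
  show ?case
    apply (rule ok_Seq, rule ok_RAssign)
     apply (simp add: eq 5 B)
    apply (simp add: eq 5)
    apply (rule ok_RAssign)
     apply (simp add: eq 5 upd_row B)
    apply (use 5(1) in \<open>simp add: eq 5(3,4) upd_row frame_upd less_Suc_eq\<close>)
    done
qed (use inp n_le_N in \<open>simp_all add: input_ok_def frame_upd\<close>)

text \<open>Each cell of \<open>B\<close> is read only just before it is overwritten, and the other
  operands come from \<open>P\<close>, \<open>Q\<close> and \<open>f\<close>. So all operands have
  the levels they had before the loop.\<close>

lemma ok_update_inverse:
  assumes inp: "input_ok \<sigma>" and f: "reals \<sigma> ''f'' 0 0 = f" "f \<in> L 3"
    and B: "\<And>i j. i < n \<Longrightarrow> j < n \<Longrightarrow> reals \<sigma> ''B'' i j \<in> L 0"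
    and PQ: "\<And>i. i < n \<Longrightarrow> reals \<sigma> ''P'' 0 i = P i" "\<And>i. i < n \<Longrightarrow> reals \<sigma> ''Q'' 0 i = Q i"
      "\<And>i. i < n \<Longrightarrow> P i \<in> L 0" "\<And>i. i < n \<Longrightarrow> Q i \<in> L 0"
  shows "ok V N update_inverse \<sigma> (\<lambda>\<tau>. frame {''i'', ''j''} {''B''} \<sigma> \<tau> \<and>
    (\<forall>i<n. \<forall>j<n. reals \<tau> ''B'' i j = reals \<sigma> ''B'' i j - f * (P i * Q j + Q i * P j)))"
  unfolding update_inverse_def
proof (rule ok_for_loop2[where n = n and m = "\<lambda>_. n" and
      I = "\<lambda>k l \<tau>. frame {''i'', ''j''} {''B''} \<sigma> \<tau> \<and>
      (\<forall>i<n. \<forall>j<n. reals \<tau> ''B'' i j = (if i < k \<or> i = k \<and> j < l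
        then reals \<sigma> ''B'' i j - f * (P i * Q j + Q i * P j) else reals \<sigma> ''B'' i j))"],
    goal_cases)
  case (12 k l \<tau>)
  have fr: "frame {''i'', ''j''} {''B''} \<sigma> \<tau>" using 12(1) by blast
  have eq: "reals \<tau> ''f'' 0 0 = f" "reals \<tau> ''P'' 0 k = P k" "reals \<tau> ''P'' 0 l = P l"
    "reals \<tau> ''Q'' 0 k = Q k" "reals \<tau> ''Q'' 0 l = Q l" "reals \<tau> ''B'' k l = reals \<sigma> ''B'' k l"
    using frameD[OF fr] f PQ 12(1-3) by simp_all
  have pq: "P k * Q l \<in> L 1" "Q k * P l \<in> L 1"
    using L_op(3)[of _ 0] PQ(3,4) 12(2,3) by simp_all
  then have sum: "P k * Q l + Q k * P l \<in> L 2" using L_op(1)[of _ 1] by (simp add: numeral_2_eq_2)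
  then have prod: "f * (P k * Q l + Q k * P l) \<in> L 4"
    using L_op(3)[OF f(2) L_mono[of 2 3]] by (simp add: eval_nat_numeral)
  have diff: "reals \<sigma> ''B'' k l - f * (P k * Q l + Q k * P l) \<in> V"
    using L_op(2)[OF L_mono[of 0 4, OF _ B[OF 12(2,3)]] prod] by (simp add: eval_nat_numeral)
  have V: "x \<in> V" if "x \<in> L k" "k \<le> 5" for x k using L_mono[OF that(2,1)] .
  show ?case
    apply (rule ok_RAssign)
     apply (use V[OF pq(1)] V[OF pq(2)] V[OF sum] V[OF prod] diff V[OF f(2)] B[OF 12(2,3)] PQ 12(2,3)
      in \<open>simp add: 12(4,5) eq L0_V\<close>)
    apply (use 12(1) in \<open>simp add: 12(4-6) upd_row eq frame_upd less_Suc_eq\<close>)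
    done
next
  case (13 k \<tau>)
  then show ?case by (auto simp: less_Suc_eq)
qed (use inp n_le_N in \<open>simp_all add: input_ok_def frame_upd upd_row\<close>)

text \<open>In the loops the outer counter is the larger index of a pair; besides the matching, the
  pairs up to position \<open>(k,l)\<close> in this order are switched on, in both
  orientations.\<close>

definition treated :: "(nat \<Rightarrow> nat) \<Rightarrow> nat \<Rightarrow> nat \<Rightarrow> nat \<Rightarrow> nat \<Rightarrow> bool" where
  "treated mu k l i j \<longleftrightarrow>
     mu j = Suc i \<or> i \<noteq> j \<and> (max i j < k \<or> max i j = k \<and> min i j < l)"

lemma ok_treat_pair:
  assumes inp: "input_ok \<sigma>" and uv: "nats \<sigma> ''u'' 0 0 = u" "nats \<sigma> ''v'' 0 0 = v" "u < n" "v < n"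
    and D: "u \<noteq> v" "\<not> D u v" "\<not> D v u" and inv: "sign_inv D (reals \<sigma> ''s'') (reals \<sigma> ''B'')"
    and D': "\<And>i j. i < n \<Longrightarrow> j < n \<Longrightarrow> D' i j \<longleftrightarrow> D i j \<or> i = u \<and> j = v \<or> i = v \<and> j = u"
  shows "ok V N (Seq choose_sign (Seq save_rows update_inverse)) \<sigma> (\<lambda>\<tau>.
    frame {''i'', ''j''} {''s'', ''a'', ''f'', ''P'', ''Q'', ''B''} \<sigma> \<tau> \<and>
    sign_inv D' (reals \<tau> ''s'') (reals \<tau> ''B''))"
proof (rule ok_Seq, rule ok_conseq[OF ok_choose_sign[OF inp uv refl sign_inv_L[OF inv uv(3,4)]]],
    rule ok_Seq, elim conjE bexE)
  fix \<tau> e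
  assume fr1: "frame {} {''s'', ''a'', ''f''} \<sigma> \<tau>" and e: "e \<in> {1, - 1}"
    and nz: "1 + e * A u v * reals \<sigma> ''B'' u v \<noteq> 0"
    and f: "reals \<tau> ''f'' 0 0 = e * A u v / (1 + e * A u v * reals \<sigma> ''B'' u v)"
    and s: "\<forall>i j. reals \<tau> ''s'' i j =
        (if i = u \<and> j = v \<or> i = v \<and> j = u then e else reals \<sigma> ''s'' i j)"
    and fL: "reals \<tau> ''f'' 0 0 \<in> L 3"
  let ?f = "reals \<tau> ''f'' 0 0"
  have inp1: "input_ok \<tau>" by (rule input_ok_frame[OF inp fr1]) auto
  have uv1: "nats \<tau> ''u'' 0 0 = u" "nats \<tau> ''v'' 0 0 = v" and B1: "reals \<tau> ''B'' = reals \<sigma> ''B''"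
    using frameD[OF fr1] uv by simp_all
  have BL: "reals \<sigma> ''B'' i j \<in> L 0" if "i < n" "j < n" for i j by (rule sign_inv_L[OF inv that])
  show "ok V N save_rows \<tau> (\<lambda>\<tau>. ok V N update_inverse \<tau> (\<lambda>\<tau>.
    frame {''i'', ''j''} {''s'', ''a'', ''f'', ''P'', ''Q'', ''B''} \<sigma> \<tau> \<and>
    sign_inv D' (reals \<tau> ''s'') (reals \<tau> ''B'')))"
  proof (rule ok_conseq[OF ok_save_rows[OF inp1 uv1]], goal_cases)
    case (3 \<upsilon>)
    then have fr2: "frame {''j''} {''P'', ''Q''} \<tau> \<upsilon>"
      and PQ: "\<And>j. j < n \<Longrightarrow> reals \<upsilon> ''P'' 0 j = reals \<sigma> ''B'' u j"
        "\<And>j. j < n \<Longrightarrow> reals \<upsilon> ''Q'' 0 j = reals \<sigma> ''B'' v j" by (auto simp: B1)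
    have inp2: "input_ok \<upsilon>" by (rule input_ok_frame[OF inp1 fr2]) auto
    have eq2: "reals \<upsilon> ''f'' 0 0 = ?f" "reals \<upsilon> ''B'' = reals \<sigma> ''B''" "reals \<upsilon> ''s'' = reals \<tau> ''s''"
      using frameD[OF fr2] B1 by simp_all
    show ?case
    proof (rule ok_conseq[OF ok_update_inverse[OF inp2 eq2(1) fL, of "reals \<sigma> ''B'' u" "reals \<sigma> ''B'' v"]],
        goal_cases)
      case (6 \<omega>)
      then have fr3: "frame {''i'', ''j''} {''B''} \<upsilon> \<omega>"
        and B3: "\<And>i j. i < n \<Longrightarrow> j < n \<Longrightarrow> reals \<omega> ''B'' i j = reals \<sigma> ''B'' i j -
          ?f * (reals \<sigma> ''B'' u i * reals \<sigma> ''B'' v j + reals \<sigma> ''B'' v i * reals \<sigma> ''B'' u j)"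
        by (auto simp: eq2)
      have s3: "reals \<omega> ''s'' i j = (if i = u \<and> j = v \<or> i = v \<and> j = u then e else reals \<sigma> ''s'' i j)"
        for i j using frameD(2)[OF fr3] s by (simp add: eq2)
      have fr12: "frame {''j''} {''s'', ''a'', ''f'', ''P'', ''Q''} \<sigma> \<upsilon>"
        by (rule frame_trans[OF fr1 fr2]) auto
      have "frame {''i'', ''j''} {''s'', ''a'', ''f'', ''P'', ''Q'', ''B''} \<sigma> \<omega>"
        by (rule frame_trans[OF fr12 fr3]) auto
      moreover have "sign_inv D' (reals \<omega> ''s'') (reals \<omega> ''B'')"
        by (rule sign_inv_update[OF inv uv(3,4) D e refl nz f s3 B3 D'])
      ultimately show ?case ..
    qed (use BL uv PQ in \<open>simp_all add: eq2\<close>)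
  qed (use BL uv in \<open>simp_all add: B1 L0_V\<close>)
qed

lemma ok_find_signing:
  assumes inp: "input_ok \<sigma>" and mu: "mu = nats \<sigma> ''mu'' 0"
    and mat: "matching mu" and all: "\<And>v. v < n \<Longrightarrow> mu v \<noteq> 0"
  shows "ok V N find_signing \<sigma> (\<lambda>\<tau>. \<exists>B. sign_inv (\<lambda>i j. True) (reals \<tau> ''s'') B)"
proof -
  let ?S = "{''u'', ''v'', ''i'', ''j''}" and ?T = "{''s'', ''a'', ''f'', ''P'', ''Q'', ''B''}"
  have mm: "\<And>i j. i < n \<Longrightarrow> mu i = Suc j \<Longrightarrow> j < n \<and> mu j = Suc i \<and> A i j \<noteq> 0"
    using mat unfolding matching_def by blast
  then have iff: "mu j = Suc i \<longleftrightarrow> mu i = Suc j" if "i < n" "j < n" for i j using that by metis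
  have loop: "ok V N (for_loop ''u'' ''n'' (for_loop ''v'' ''u''
        (IfElse (IEq (elem ''mu'' (cell ''v'')) (IAdd (cell ''u'') (IConst 1)))
           Skip (Seq choose_sign (Seq save_rows update_inverse))))) \<tau>
     (\<lambda>\<tau>. \<exists>B. sign_inv (\<lambda>i j. True) (reals \<tau> ''s'') B)"
    if fr0: "frame {''u'', ''v''} {''s'', ''B''} \<sigma> \<tau>"
      and inv0: "sign_inv (\<lambda>i j. mu j = Suc i) (reals \<tau> ''s'') (reals \<tau> ''B'')" for \<tau>
  proof (rule ok_for_loop2[where n = n and m = "\<lambda>k. k" and
      I = "\<lambda>k l \<tau>. frame ?S ?T \<sigma> \<tau> \<and> sign_inv (treated mu k l) (reals \<tau> ''s'') (reals \<tau> ''B'')"],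
      goal_cases)
    case 5
    show ?case using input_ok_frame[OF inp fr0] by (simp add: input_ok_def)
  next
    case 7
    have "frame ?S ?T \<sigma> \<tau>" by (rule frame_trans[OF fr0 frame_refl[of "{}" "{}"]]) auto
    moreover have "sign_inv (treated mu 0 0) (reals \<tau> ''s'') (reals \<tau> ''B'')"
      by (rule sign_inv_cong[OF inv0]) (auto simp: treated_def)
    ultimately show ?case ..
  next
    case (12 k l \<tau>)
    then have fr: "frame ?S ?T \<sigma> \<tau>"
      and inv: "sign_inv (treated mu k l) (reals \<tau> ''s'') (reals \<tau> ''B'')" by blast+
    have inp': "input_ok \<tau>" by (rule input_ok_frame[OF inp fr]) auto
    have ln: "l < n" using 12(2,3) by simp
    have mu': "nats \<tau> ''mu'' 0 = mu" using frameD[OF fr] mu by simp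
    have step: "treated mu k (Suc l) i j \<longleftrightarrow>
        treated mu k l i j \<or> i = k \<and> j = l \<or> i = l \<and> j = k" for i j
      using 12(3) by (auto simp: treated_def max_def min_def)
    show ?case
    proof (rule ok_IfElse, goal_cases)
      case 2
      then have *: "mu l = Suc k" using 12(4,5) by (simp add: mu')
      then have "mu k = Suc l" using iff[OF 12(2) ln] by simp
      \<comment> \<open>A matching edge has been switched on from the start, so skipping it loses
        nothing.\<close>
      with * have "treated mu k (Suc l) = treated mu k l"
        by (intro ext) (auto simp: step, auto simp: treated_def)
      then show ?case using fr inv 12(4-6) by (intro ok_Skip) simp
    next
      case 3
      then have *: "mu l \<noteq> Suc k" using 12(4,5) by (simp add: mu')
      then have "mu k \<noteq> Suc l" using iff[OF 12(2) ln] by simp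
      with * have nt: "\<not> treated mu k l k l" "\<not> treated mu k l l k"
        using 12(3) by (auto simp: treated_def)
      show ?case
      proof (rule ok_conseq[OF ok_treat_pair[OF inp' 12(4,5,2) ln _ nt inv step]], goal_cases)
        case (2 \<upsilon>)
        then have fr': "frame {''i'', ''j''} ?T \<tau> \<upsilon>" by blast
        have "frame ?S ?T \<sigma> \<upsilon>" by (rule frame_trans[OF fr fr']) auto
        then show ?case using 2 frameD(1)[OF fr'] 12(4-6) by simp
      qed (use 12(3) in simp)
    qed simp
  next
    case (13 k \<tau>)
    \<comment> \<open>Distinct indices with maximum \<open>k\<close> have a minimum below
      \<open>k\<close>, so the pairs of row \<open>k\<close> are complete after \<open>k\<close>
      steps.\<close>
    have "treated mu (Suc k) 0 = treated mu k k"
      by (intro ext) (auto simp: treated_def max_def min_def)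
    then show ?case using 13 by simp
  next
    case (14 \<tau>)
    \<comment> \<open>Only the diagonal has been left out, and there \<open>A\<close> vanishes by
      \<open>A_side\<close>.\<close>
    have "sign_inv (\<lambda>i j. True) (reals \<tau> ''s'') (reals \<tau> ''B'')"
      by (rule sign_inv_cong[OF conjunct2[OF 14]]) (use A_side in \<open>auto simp: treated_def\<close>)
    then show ?case by blast
  qed (use n_le_N in \<open>auto simp: frame_upd upd_row\<close>)
  show ?thesis
    unfolding find_signing_def
    by (rule ok_Seq, rule ok_conseq[OF ok_init_signing[OF inp mu mat all]]) (use loop in auto)
qed

lemma ok_signing_algorithm:
  assumes inp: "input_ok \<sigma>" and zero: "nats \<sigma> ''fail'' 0 0 = 0" "\<And>v. nats \<sigma> ''mu'' 0 v = 0"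
    "nats \<sigma> ''answer'' 0 0 = 0"
  shows "ok V N signing_algorithm \<sigma> (\<lambda>\<tau>.
    if accepts \<tau> then \<exists>B. sign_inv (\<lambda>i j. True) (reals \<tau> ''s'') B else no_perm)"
  unfolding signing_algorithm_def
proof (rule ok_Seq, rule ok_conseq[OF ok_find_matching[OF inp zero(1,2)]], rule ok_IfElse, goal_cases)
  case (2 \<tau>)
  then have *: "input_ok \<tau>" "matching (nats \<tau> ''mu'' 0)" "\<And>v. v < n \<Longrightarrow> nats \<tau> ''mu'' 0 v \<noteq> 0"
    by (auto simp: phase_post_def)
  show ?case
    by (rule ok_Seq, rule ok_conseq[OF ok_find_signing[OF *(1) refl *(2,3)]], simp, rule ok_IAssign)
       (simp add: accepts_def upd_row)
next
  case (3 \<tau>)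
  then show ?case using zero(3) by (intro ok_Skip) (simp add: accepts_def phase_post_def)
qed simp

end

section \<open>Bit lengths\<close>

text \<open>The fractions need not be in lowest terms, so sizes of sums and products can be read off
  directly; reduction is dealt with once, in \<open>bit_weight_le\<close>.\<close>

definition rats_upto :: "nat \<Rightarrow> real set" where
  "rats_upto K = {of_int p / of_int q | p q. \<bar>p\<bar> \<le> int K \<and> 0 < q \<and> q \<le> int K}"

lemma rats_uptoI: "x = of_int p / of_int q \<Longrightarrow> \<bar>p\<bar> \<le> int K \<Longrightarrow> 0 < q \<Longrightarrow> q \<le> int K \<Longrightarrow> x \<in> rats_upto K"
  by (auto simp: rats_upto_def)

lemma rats_upto_mono: "K \<le> K' \<Longrightarrow> rats_upto K \<subseteq> rats_upto K'"
  unfolding rats_upto_def by fastforce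

text \<open>Determinants and divisors can be negative; their sign is moved to the numerator.\<close>

lemma rats_uptoI_nonzero:
  assumes "x = of_int p / of_int q" "\<bar>p\<bar> \<le> int K" "q \<noteq> 0" "\<bar>q\<bar> \<le> int K"
  shows "x \<in> rats_upto K"
proof (cases "0 < q")
  case True
  then show ?thesis using assms by (intro rats_uptoI[of x p q]) auto
next
  case False
  then show ?thesis using assms by (intro rats_uptoI[of x "- p" "- q"]) auto
qed

text \<open>Over the common denominator the numerator of a sum is a sum of two products, whence the
  factor 2. Division by 0 yields 0, represented as 0/1, which needs
  \<open>1 \<le> K\<close>.\<close>

lemma rats_upto_op:
  assumes "x \<in> rats_upto K" "y \<in> rats_upto K" and K: "1 \<le> K"
  shows "x + y \<in> rats_upto (2 * K\<^sup>2)" "x - y \<in> rats_upto (2 * K\<^sup>2)"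
    "x * y \<in> rats_upto (2 * K\<^sup>2)" "x / y \<in> rats_upto (2 * K\<^sup>2)"
proof -
  obtain p q where x: "x = of_int p / of_int q" "\<bar>p\<bar> \<le> int K" "0 < q" "q \<le> int K"
    using assms(1) by (auto simp: rats_upto_def)
  obtain r s where y: "y = of_int r / of_int s" "\<bar>r\<bar> \<le> int K" "0 < s" "s \<le> int K"
    using assms(2) by (auto simp: rats_upto_def)
  have K2: "int (2 * K\<^sup>2) = int K * int K + int K * int K" by (simp add: power2_eq_square)
  have b: "\<bar>a * b\<bar> \<le> int K * int K" if "\<bar>a\<bar> \<le> int K" "\<bar>b\<bar> \<le> int K" for a b :: int
    using that by (simp add: abs_mult mult_mono)
  have le: "\<bar>a * b\<bar> \<le> int (2 * K\<^sup>2)" if "\<bar>a\<bar> \<le> int K" "\<bar>b\<bar> \<le> int K" for a b :: int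
    using b[OF that] unfolding K2 by simp
  have qs: "0 < q * s" "q * s \<le> int (2 * K\<^sup>2)" using le[of q s] x y by auto
  have ps: "\<bar>p * s\<bar> \<le> int K * int K" "\<bar>r * q\<bar> \<le> int K * int K" using b x y by auto
  have "\<bar>p * s + r * q\<bar> \<le> int (2 * K\<^sup>2)" "\<bar>p * s - r * q\<bar> \<le> int (2 * K\<^sup>2)"
    unfolding K2 using ps by linarith+
  moreover have "x + y = of_int (p * s + r * q) / of_int (q * s)"
    "x - y = of_int (p * s - r * q) / of_int (q * s)"
    unfolding x(1) y(1) using x(3) y(3) by (simp_all add: add_frac_eq diff_frac_eq)
  ultimately show "x + y \<in> rats_upto (2 * K\<^sup>2)" "x - y \<in> rats_upto (2 * K\<^sup>2)"
    using rats_uptoI[OF _ _ qs] by blast+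
  show "x * y \<in> rats_upto (2 * K\<^sup>2)"
    using x y le by (intro rats_uptoI[OF _ _ qs, of _ "p * r"]) auto
  show "x / y \<in> rats_upto (2 * K\<^sup>2)"
  proof (cases "r = 0")
    case True
    have "1 \<le> int K * int K" using K mult_mono[of 1 "int K" 1 "int K"] by simp
    then show ?thesis using True y by (intro rats_uptoI[of _ 0 1]) (auto simp: power2_eq_square)
  next
    case False
    then show ?thesis
      using x y le[of p s] le[of q r] by (intro rats_uptoI_nonzero[of _ "p * s" "q * r"]) auto
  qed
qed

lemma bit_weight_of_rat:
  "quotient_of r = (p, q) \<Longrightarrow> bit_weight (of_rat r) = floorlog 2 (nat \<bar>p\<bar>) + floorlog 2 (nat q)"
proof -
  have "(THE r'. (of_rat r :: real) = of_rat r') = r" by (rule the_equality) auto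
  then show "quotient_of r = (p, q) \<Longrightarrow> ?thesis" by (simp add: bit_weight_def)
qed

text \<open>Passing to lowest terms increases neither part: the reduced denominator is coprime to
  the reduced numerator and therefore divides the given denominator.\<close>

lemma bit_weight_le:
  assumes "x \<in> rats_upto (2 ^ m)"
  shows "bit_weight x \<le> 2 * (m + 1)"
proof -
  obtain p q where pq: "x = of_int p / of_int q" "\<bar>p\<bar> \<le> 2 ^ m" "0 < q" "q \<le> 2 ^ m"
    using assms by (auto simp: rats_upto_def)
  have x: "x = of_rat (Rat.Fract p q)" using pq by (simp add: of_rat_rat)
  obtain a b where ab: "quotient_of (Rat.Fract p q) = (a, b)" by force
  have "\<bar>a\<bar> \<le> \<bar>p\<bar>" "b \<le> q" "0 < b"
  proof -
    show b: "0 < b" using quotient_of_denom_pos[OF ab] .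
    have "Rat.Fract a b = Rat.Fract p q" using quotient_of_eq[OF ab] .
    then have eq: "a * q = p * b" using pq b by (simp add: eq_rat)
    have "coprime b a" using quotient_of_coprime[OF ab] by (simp add: coprime_commute)
    moreover have "b dvd a * q" using eq by simp
    ultimately have "b dvd q" by (simp add: coprime_dvd_mult_right_iff)
    then show bq: "b \<le> q" using pq(3) by (rule zdvd_imp_le)
    show "\<bar>a\<bar> \<le> \<bar>p\<bar>"
    proof (rule ccontr)
      assume "\<not> ?thesis"
      then have "\<bar>p\<bar> * b < \<bar>a\<bar> * q" using b bq
        by (intro mult_less_le_imp_less) auto
      moreover have "\<bar>a\<bar> * q = \<bar>p\<bar> * b" using eq pq(3) b by (metis abs_mult abs_of_pos)
      ultimately show False by simp
    qed
  qed
  then have "\<bar>a\<bar> \<le> 2 ^ m" "b \<le> 2 ^ m" using pq by linarith+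
  moreover have "(2 :: int) ^ m < 2 ^ (m + 1)" by simp
  ultimately have "\<bar>a\<bar> < 2 ^ (m + 1)" "b < 2 ^ (m + 1)" by linarith+
  then have "nat \<bar>a\<bar> < 2 ^ (m + 1)" "nat b < 2 ^ (m + 1)" using \<open>0 < b\<close> by (auto simp: nat_less_iff)
  then have "floorlog 2 (nat \<bar>a\<bar>) \<le> m + 1" "floorlog 2 (nat b) \<le> m + 1"
    by (auto intro!: floorlog_leI)
  then show ?thesis unfolding x bit_weight_of_rat[OF ab] by simp
qed

text \<open>The denominator always has a digit, so even a zero entry has weight at least 1. This is
  what later bounds the dimension by the length of the input.\<close>

lemma bit_weight_fraction:
  assumes "x \<in> \<rat>"
  obtains p q where "x = of_int p / of_int q" "0 < q" "\<bar>p\<bar> \<le> 2 ^ bit_weight x"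
    "q \<le> 2 ^ bit_weight x" "1 \<le> bit_weight x"
proof -
  obtain r where r: "x = of_rat r" using assms by (auto simp: Rats_def)
  obtain p q where pq: "quotient_of r = (p, q)" by force
  have w: "bit_weight x = floorlog 2 (nat \<bar>p\<bar>) + floorlog 2 (nat q)"
    unfolding r by (rule bit_weight_of_rat[OF pq])
  have q: "0 < q" using quotient_of_denom_pos[OF pq] .
  have "x = of_int p / of_int q" unfolding r quotient_of_div[OF pq] by (simp add: of_rat_divide)
  moreover have "floorlog 2 (nat q) \<noteq> 0" using q by (simp add: floorlog_eq_zero_iff)
  then have "1 \<le> bit_weight x" using w by simp
  moreover have "nat \<bar>p\<bar> < 2 ^ bit_weight x" "nat q < 2 ^ bit_weight x"
    by (rule floorlog_leD; simp add: w)+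
  then have "\<bar>p\<bar> \<le> 2 ^ bit_weight x" "q \<le> 2 ^ bit_weight x"
    by (simp_all add: nat_less_iff)
  ultimately show ?thesis using that q by blast
qed

section \<open>Cramer's rule and the size of inverses\<close>

lemma abs_det_le:
  fixes Z :: "int mat"
  assumes Z: "Z \<in> carrier_mat m m" and T: "\<And>i j. i < m \<Longrightarrow> j < m \<Longrightarrow> \<bar>Z $$ (i, j)\<bar> \<le> T"
  shows "\<bar>det Z\<bar> \<le> fact m * T ^ m"
proof -
  have "\<bar>det Z\<bar> \<le> (\<Sum>p | p permutes {0..<m}. \<bar>signof p * (\<Prod>i = 0..<m. Z $$ (i, p i))\<bar>)"
    unfolding det_def'[OF Z] by (rule sum_abs)
  also have "\<dots> \<le> (\<Sum>p | p permutes {0..<m}. T ^ m)"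
  proof (rule sum_mono)
    fix p assume "p \<in> {p. p permutes {0..<m}}"
    then have p: "p i < m" if "i < m" for i using that permutes_in_image[of p "{0..<m}" i] by simp
    have "\<bar>signof p * (\<Prod>i = 0..<m. Z $$ (i, p i))\<bar> = (\<Prod>i = 0..<m. \<bar>Z $$ (i, p i)\<bar>)"
      by (simp add: abs_mult abs_prod sign_def)
    also have "\<dots> \<le> (\<Prod>i = 0..<m. T)" using T p by (intro prod_mono) auto
    finally show "\<bar>signof p * (\<Prod>i = 0..<m. Z $$ (i, p i))\<bar> \<le> T ^ m" by simp
  qed
  also have "\<dots> = fact m * T ^ m" by (simp add: card_permutations)
  finally show ?thesis .
qed

text \<open>For the integer matrix \<open>Z\<close>, which is \<open>D\<close> times
  \<open>G\<close>, Cramer's rule expresses an entry of \<open>B\<close> as \<open>D\<close> times a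
  cofactor of \<open>Z\<close> over \<open>det Z\<close>. Leibniz bounds both determinants by
  \<open>fact n * T ^ n\<close>.\<close>

lemma inverse_entry_rats_upto:
  fixes G B :: "real mat"
  assumes G: "G \<in> carrier_mat n n" and B: "B \<in> carrier_mat n n" and GB: "G * B = 1\<^sub>m n"
    and D: "0 < D" and Z: "\<And>i j. i < n \<Longrightarrow> j < n \<Longrightarrow> of_int D * G $$ (i, j) = of_int (Z i j)"
    and T: "1 \<le> T" "\<And>i j. i < n \<Longrightarrow> j < n \<Longrightarrow> \<bar>Z i j\<bar> \<le> T"
    and K: "D * (fact n * T ^ n) \<le> int K" and ij: "i < n" "j < n"
  shows "B $$ (i, j) \<in> rats_upto K"
proof -
  define ZI where "ZI = mat n n (\<lambda>(i, j). Z i j)"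
  define ZR where "ZR = map_mat real_of_int ZI"
  have ZI: "ZI \<in> carrier_mat n n" and ZR: "ZR \<in> carrier_mat n n" by (auto simp: ZI_def ZR_def)
  have ZG: "ZR = of_int D \<cdot>\<^sub>m G"
    using G Z by (intro eq_matI) (auto simp: ZR_def ZI_def)
  have dR: "det ZR = of_int (det ZI)" unfolding ZR_def by (simp add: of_int_hom.hom_det)
  have "det G * det B = 1" using det_mult[OF G B] GB by simp
  then have "det ZR \<noteq> 0" using D G by (auto simp: ZG)
  then have dnz: "det ZI \<noteq> 0" by (simp add: dR)
  note adj = adj_mat[OF ZR]
  \<comment> \<open>The product of adjugate, \<open>ZR\<close> and \<open>B\<close> is evaluated in
    two ways, as \<open>det ZR\<close> times \<open>B\<close> and as \<open>D\<close> times the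
    adjugate.\<close>
  have "(adj_mat ZR * ZR) * B = adj_mat ZR * (of_int D \<cdot>\<^sub>m (G * B))"
    using assoc_mult_mat[OF adj(1) ZR B] by (simp add: ZG mult_smult_assoc_mat[OF G B])
  also have "\<dots> = of_int D \<cdot>\<^sub>m adj_mat ZR"
    using adj(1) by (simp add: GB mult_smult_distrib[OF adj(1) one_carrier_mat])
  finally have "det ZR \<cdot>\<^sub>m B = of_int D \<cdot>\<^sub>m adj_mat ZR"
    using B by (simp add: adj(3) mult_smult_assoc_mat[OF one_carrier_mat B])
  then have "det ZR * B $$ (i, j) = of_int D * adj_mat ZR $$ (i, j)"
    using arg_cong[of _ _ "\<lambda>X. X $$ (i, j)"] B adj(1) ij by (metis carrier_matD index_smult_mat(1))
  also have "adj_mat ZR $$ (i, j) = cofactor ZR j i" using ZR ij by (simp add: adj_mat_def)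
  also have "\<dots> = of_int (cofactor ZI j i)"
  proof -
    have "mat_delete ZR j i = map_mat of_int (mat_delete ZI j i)"
      using ij by (intro eq_matI) (auto simp: mat_delete_def ZR_def ZI_def)
    then show ?thesis by (simp add: cofactor_def of_int_hom.hom_det)
  qed
  finally have eq: "B $$ (i, j) = of_int (D * cofactor ZI j i) / of_int (det ZI)"
    using dnz by (simp add: dR field_simps)
  have "\<bar>det ZI\<bar> \<le> 1 * (fact n * T ^ n)"
    using abs_det_le[OF ZI, of T] T(2) by (simp add: ZI_def)
  also have "\<dots> \<le> D * (fact n * T ^ n)" using D T(1) by (intro mult_right_mono) auto
  finally have 1: "\<bar>det ZI\<bar> \<le> int K" using K by simp
  have md: "mat_delete ZI j i \<in> carrier_mat (n - 1) (n - 1)" using ZI by (rule mat_delete_carrier)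
  have "\<bar>det (mat_delete ZI j i)\<bar> \<le> fact (n - 1) * T ^ (n - 1)"
    using T(2) by (intro abs_det_le[OF md]) (auto simp: mat_delete_def ZI_def)
  also have "\<dots> \<le> fact n * T ^ n"
    using T(1) by (intro mult_mono power_increasing fact_mono) auto
  finally have "\<bar>D * cofactor ZI j i\<bar> \<le> D * (fact n * T ^ n)"
    using D by (simp add: cofactor_def abs_mult power_abs)
  then have 2: "\<bar>D * cofactor ZI j i\<bar> \<le> int K" using K by simp
  show ?thesis by (rule rats_uptoI_nonzero[OF eq 2 dnz 1])
qed

text \<open>The exponent \<open>E\<close> covers level 0, that is, the entries of \<open>A\<close>
  and the Cramer bound for inverses. An operation takes \<open>K\<close> to \<open>2 * K^2\<close>,
  hence an exponent \<open>e\<close> to \<open>2 * e + 1\<close>, which is at most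
  \<open>3 * e\<close> for \<open>e \<ge> 1\<close>; so level \<open>k\<close> gets the factor
  \<open>3 ^ k\<close>.\<close>

lemma rational_bipartite_input:
  fixes A :: "nat \<Rightarrow> nat \<Rightarrow> real"
  assumes sym: "\<And>i j. i < n \<Longrightarrow> j < n \<Longrightarrow> A i j = A j i"
    and side: "\<And>i j. i < n \<Longrightarrow> j < n \<Longrightarrow> A i j \<noteq> 0 \<Longrightarrow> side i \<noteq> side j"
    and rat: "\<And>i j. i < n \<Longrightarrow> j < n \<Longrightarrow> A i j \<in> \<rat>"
    and S: "S = (\<Sum>i<n. \<Sum>j<n. bit_weight (A i j))" and E: "E = 4 * S\<^sup>2 + S + 1"
  shows "bipartite_input n A side (\<lambda>k. rats_upto (2 ^ (3 ^ k * E)))" and "n \<le> S"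
proof -
  have "\<forall>i j. \<exists>p q. i < n \<longrightarrow> j < n \<longrightarrow> A i j = of_int p / of_int q \<and> 0 < q \<and>
      \<bar>p\<bar> \<le> 2 ^ bit_weight (A i j) \<and> q \<le> 2 ^ bit_weight (A i j) \<and> 1 \<le> bit_weight (A i j)"
    using rat bit_weight_fraction by metis
  then obtain p q where pq: "\<And>i j. i < n \<Longrightarrow> j < n \<Longrightarrow> A i j = of_int (p i j) / of_int (q i j) \<and>
      0 < q i j \<and> \<bar>p i j\<bar> \<le> 2 ^ bit_weight (A i j) \<and> q i j \<le> 2 ^ bit_weight (A i j) \<and>
      1 \<le> bit_weight (A i j)"
    by metis
  have q0: "0 < q i j" and qw: "q i j \<le> 2 ^ bit_weight (A i j)" and w1: "1 \<le> bit_weight (A i j)" if "i < n" "j < n" for i j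
    using pq[OF that] by blast+
  have "(\<Sum>i<n. \<Sum>j<n. 1) \<le> S" unfolding S using w1 by (intro sum_mono) simp
  then have nnS: "n * n \<le> S" by simp
  then show nS: "n \<le> S" using le_square order_trans by blast
  have wS: "bit_weight (A i j) \<le> S" if "i < n" "j < n" for i j
  proof -
    have "bit_weight (A i j) \<le> (\<Sum>j<n. bit_weight (A i j))"
      using that by (intro member_le_sum) auto
    also have "\<dots> \<le> S" unfolding S using that by (intro member_le_sum) auto
    finally show ?thesis .
  qed
  have pS: "\<bar>p i j\<bar> \<le> 2 ^ S" and qS: "q i j \<le> 2 ^ S" if "i < n" "j < n" for i j
    using pq[OF that] power_increasing[OF wS[OF that], of "2::int"] by linarith+
  \<comment> \<open>The product of all denominators is a common denominator; its length stays below
    \<open>S\<close> because \<open>S\<close> adds up the weights of all entries.\<close>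
  define D where "D = (\<Prod>i<n. \<Prod>j<n. q i j)"
  have D: "0 < D" unfolding D_def using q0 by (intro prod_pos) auto
  have "D \<le> (\<Prod>i<n. \<Prod>j<n. 2 ^ bit_weight (A i j))"
    unfolding D_def
    by (intro prod_mono conjI prod_nonneg) (use qw q0 in \<open>simp_all add: order.strict_implies_order\<close>)
  also have "\<dots> = 2 ^ S" by (simp add: S power_sum)
  finally have DS: "D \<le> 2 ^ S" .
  define Z where "Z i j = D div q i j * p i j" for i j
  have qD: "q i j dvd D" if "i < n" "j < n" for i j
  proof -
    have "q i j dvd (\<Prod>j<n. q i j)" using that by (intro dvd_prodI) auto
    also have "\<dots> dvd D" unfolding D_def using that by (intro dvd_prodI) auto
    finally show ?thesis .
  qed
  have Z: "of_int D * A i j = of_int (Z i j)" "\<bar>Z i j\<bar> \<le> 2 ^ (2 * S)" if ij: "i < n" "j < n" for i j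
  proof -
    obtain c where c: "D = q i j * c" using qD[OF ij] by blast
    note q0 = q0[OF ij]
    have Zc: "Z i j = c * p i j" using c q0 by (simp add: Z_def)
    show "of_int D * A i j = of_int (Z i j)"
      using pq[OF ij] c by (simp add: Zc)
    have c0: "0 < c" using c D q0 by (simp add: zero_less_mult_iff)
    have "c \<le> D" using c q0 c0 by simp
    then have "\<bar>c\<bar> * \<bar>p i j\<bar> \<le> 2 ^ S * 2 ^ S" using c0 DS pS[OF ij] by (intro mult_mono) auto
    then show "\<bar>Z i j\<bar> \<le> 2 ^ (2 * S)" by (simp add: Zc abs_mult mult_2 power_add)
  qed
  have K: "D * (fact n * (2 ^ (2 * S)) ^ n) \<le> int (2 ^ E)"
  proof -
    \<comment> \<open>The factorial is absorbed by \<open>n ^ n\<close>, which is at most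
      \<open>2 ^ (n * n)\<close>. The total exponent is then \<open>S + n * n + 2 * S * n\<close>,
      bounded in terms of \<open>S\<close> since \<open>n \<le> S\<close>.\<close>
    have "(fact n :: int) \<le> of_nat (n ^ n)" by (rule fact_le_power)
    also have "\<dots> = int n ^ n" by simp
    also have "\<dots> \<le> (2 ^ n) ^ n" by (intro power_mono) (auto intro: order.strict_implies_order)
    finally have "(fact n :: int) \<le> 2 ^ (n * n)" by (simp add: power_mult)
    then have "D * (fact n * (2 ^ (2 * S)) ^ n) \<le> 2 ^ S * (2 ^ (n * n) * (2 ^ (2 * S)) ^ n)"
      using DS D by (intro mult_mono) auto
    also have "\<dots> = 2 ^ (S + n * n + 2 * S * n)" by (simp add: power_add power_mult)
    also have "\<dots> \<le> 2 ^ E"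
    proof (rule power_increasing)
      have "n * n \<le> S * S" "S * n \<le> S * S" using nS by (auto intro: mult_mono)
      then have "n * n + 2 * (S * n) \<le> 3 * (S * S)" by linarith
      then show "S + n * n + 2 * S * n \<le> E" unfolding E power2_eq_square mult.assoc by linarith
    qed simp
    finally show ?thesis by simp
  qed
  have E1: "1 \<le> E" "S \<le> E" by (auto simp: E)
  have le_E: "x \<le> 2 ^ E" if "x \<le> 2 ^ S" for x :: int
    using that power_increasing[OF E1(2), of "2::int"] by linarith
  show "bipartite_input n A side (\<lambda>k. rats_upto (2 ^ (3 ^ k * E)))"
  proof (unfold_locales, goal_cases)
    case (6 k)
    show ?case by (rule rats_upto_mono) (auto intro!: power_increasing)
  next
    case (13 G B i j)
    let ?G = "mat n n (\<lambda>(i, j). G i j)" and ?B = "mat n n (\<lambda>(i, j). B i j)"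
    \<comment> \<open>The zero or sign pattern of \<open>G\<close> carries over to the integers
      \<open>Z\<close>, so the common denominator of \<open>A\<close> also works for
      \<open>G\<close>.\<close>
    let ?Z = "\<lambda>i j. if G i j = 0 then 0 else if G i j = A i j then Z i j else - Z i j"
    have "?G * ?B = 1\<^sub>m n"
      using 13(2) by (intro eq_matI) (auto simp: scalar_prod_def atLeast0LessThan)
    then have "?B $$ (i, j) \<in> rats_upto (2 ^ E)"
    proof (rule inverse_entry_rats_upto[OF _ _ _ D _ _ _ K 13(3,4), rotated 2])
      show "of_int D * ?G $$ (i, j) = of_int (?Z i j)" if "i < n" "j < n" for i j
        using 13(1)[OF that] Z(1)[OF that] that by auto
      show "\<bar>?Z i j\<bar> \<le> 2 ^ (2 * S)" if "i < n" "j < n" for i j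
        using Z(2)[OF that] by auto
    qed auto
    then show ?case using 13(3,4) by simp
  next
    case (11 i j)
    then show ?case
      using pq[OF 11] le_E[OF pS[OF 11]] le_E[OF qS[OF 11]]
      by (intro rats_uptoI[of _ "p i j" "q i j"]) simp_all
  next
    case (12 i j)
    then show ?case
      using pq[OF 12] le_E[OF pS[OF 12]] le_E[OF qS[OF 12]]
      by (intro rats_uptoI[of _ "- p i j" "q i j"]) simp_all
  next
    \<comment> \<open>Here \<open>E \<ge> 1\<close> absorbs the factor 2, turning
      \<open>1 + 2 * e\<close> into at most \<open>3 * e\<close>.\<close>
    have le: "2 * (2 ^ (3 ^ k * E))\<^sup>2 \<le> (2 :: nat) ^ (3 ^ Suc k * E)" for k
    proof -
      have "2 * (2 ^ (3 ^ k * E))\<^sup>2 = (2 :: nat) ^ (1 + 2 * (3 ^ k * E))"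
        by (simp add: power_mult power2_eq_square mult_2 power_add)
      also have "\<dots> \<le> 2 ^ (3 ^ Suc k * E)"
        using E1(1) by (intro power_increasing) (auto simp: Suc_le_eq)
      finally show ?thesis .
    qed
    {
      case (7 x k y) then show ?case by (intro subsetD[OF rats_upto_mono[OF le] rats_upto_op(1)]) auto
    next
      case (8 x k y) then show ?case by (intro subsetD[OF rats_upto_mono[OF le] rats_upto_op(2)]) auto
    next
      case (9 x k y) then show ?case by (intro subsetD[OF rats_upto_mono[OF le] rats_upto_op(3)]) auto
    next
      case (10 x k y) then show ?case by (intro subsetD[OF rats_upto_mono[OF le] rats_upto_op(4)]) auto
    }
  next
    case 3 show ?case by (rule rats_uptoI[of _ 0 1]) auto
  next
    case 4 show ?case by (rule rats_uptoI[of _ 1 1]) auto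
  next
    case 5 show ?case by (rule rats_uptoI[of _ "- 1" 1]) auto
  qed (rule sym side; assumption)+
qed

lemma cbound_mono: "N \<le> N' \<Longrightarrow> cbound N c \<le> cbound N' c"
  by (induction c) (auto intro!: add_mono mult_mono)

section \<open>From invariants to matrices and the final time bounds\<close>

context bipartite_input
begin

lemma sign_inv_invertible:
  assumes M: "M \<in> carrier_mat n n" "\<And>i j. i < n \<Longrightarrow> j < n \<Longrightarrow> M $$ (i, j) = A i j"
    and inv: "sign_inv (\<lambda>i j. True) (reals \<tau> ''s'') B"
  shows "invertible_symmetric_signing M (output_mat n \<tau>)"
proof -
  let ?s = "output_mat n \<tau>" and ?B = "mat n n (\<lambda>(i, j). B i j)"
  have "is_signing n ?s"
    by (auto simp: is_signing_def output_mat_def elements_mat_def dest: sign_invD(1)[OF inv])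
  moreover have "symmetric_mat ?s"
    using sign_invD(2)[OF inv] by (auto simp: symmetric_mat_def output_mat_def intro!: eq_matI)
  moreover have "invertible_mat (hadamard_mat M ?s)"
  proof -
    let ?H = "hadamard_mat M ?s"
    have H: "?H \<in> carrier_mat n n" and B: "?B \<in> carrier_mat n n"
      using M(1) by (auto simp: hadamard_mat_def)
    have HB: "?H * ?B = 1\<^sub>m n"
    proof (rule eq_matI)
      fix i j assume "i < dim_row (1\<^sub>m n :: real mat)" "j < dim_col (1\<^sub>m n :: real mat)"
      then have ij: "i < n" "j < n" by auto
      have "(?H * ?B) $$ (i, j) = (\<Sum>k<n. of_bool True * A i k * reals \<tau> ''s'' i k * B k j)"
        using ij M by (simp add: hadamard_mat_def output_mat_def scalar_prod_def atLeast0LessThan)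
      then show "(?H * ?B) $$ (i, j) = 1\<^sub>m n $$ (i, j)" using sign_invD(5)[OF inv ij] ij by simp
    qed (use H B in auto)
    moreover have "?B * ?H = 1\<^sub>m n" by (rule mat_mult_left_right_inverse[OF H B HB])
    ultimately show ?thesis
      using H B unfolding invertible_mat_def inverts_mat_def by (auto intro!: exI[of _ ?B])
  qed
  ultimately show ?thesis using M(1) by (simp add: invertible_symmetric_signing_def)
qed

lemma no_perm_not_invertible:
  assumes M: "M \<in> carrier_mat n n" "\<And>i j. i < n \<Longrightarrow> j < n \<Longrightarrow> M $$ (i, j) = A i j"
    and no_perm
  shows "\<not> invertible_symmetric_signing M s"
proof
  assume "invertible_symmetric_signing M s"
  then have inv: "invertible_mat (hadamard_mat M s)" by (simp add: invertible_symmetric_signing_def)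
  let ?H = "hadamard_mat M s"
  have H: "?H \<in> carrier_mat n n" using M(1) by (auto simp: hadamard_mat_def)
  obtain B where B: "?H * B = 1\<^sub>m n" "B * ?H = 1\<^sub>m (dim_row B)"
    using inv H by (auto simp: invertible_mat_def inverts_mat_def)
  then have "B \<in> carrier_mat n n"
    using H by (metis carrier_matD(2) carrier_matI index_mult_mat(2,3) index_one_mat(2,3))
  from det_mult[OF H this] B(1) have "det ?H \<noteq> 0" by auto
  then obtain \<pi> where \<pi>: "\<pi> permutes {0..<n}" "(\<Prod>i = 0..<n. ?H $$ (i, \<pi> i)) \<noteq> 0"
    unfolding det_def'[OF H] by (auto elim: sum.not_neutral_contains_not_neutral)
  have "A i (\<pi> i) \<noteq> 0" if "i < n" for i
  proof -
    have "\<pi> i < n" using permutes_in_image[OF \<pi>(1), of i] that by simp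
    moreover have "?H $$ (i, \<pi> i) \<noteq> 0" using \<pi>(2) that by simp
    ultimately show ?thesis using that M by (auto simp: hadamard_mat_def)
  qed
  with \<pi>(1) \<open>no_perm\<close> show False by (auto simp: no_perm_def atLeast0LessThan)
qed

text \<open>The level family is still arbitrary, so the result can be taken once for all reals and
  once for bounded fractions.\<close>

lemma runs_signing_algorithm:
  assumes M: "M \<in> carrier_mat n n" "\<And>i j. i < n \<Longrightarrow> j < n \<Longrightarrow> M $$ (i, j) = A i j"
  obtains \<tau> where "runs V signing_algorithm (input_state M) (cbound N signing_algorithm) \<tau>"
    "accepts \<tau> \<longleftrightarrow> (\<exists>s. invertible_symmetric_signing M s)"
    "accepts \<tau> \<longrightarrow> invertible_symmetric_signing M (output_mat n \<tau>)"
proof -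
  have "input_ok (input_state M)" using M by (simp add: input_ok_def input_state_def upd_row)
  from ok_signing_algorithm[OF this] obtain \<tau>
    where \<tau>: "runs V signing_algorithm (input_state M) (cbound N signing_algorithm) \<tau>"
      "if accepts \<tau> then \<exists>B. sign_inv (\<lambda>i j. True) (reals \<tau> ''s'') B else no_perm"
    by (auto simp: ok_def input_state_def upd_row)
  show ?thesis
    using that[OF \<tau>(1)] \<tau>(2) sign_inv_invertible[OF M] no_perm_not_invertible[OF M]
    by (cases "accepts \<tau>") auto
qed

end

theorem theorem5:
  shows "\<exists>c. poly_time_algorithm c
     {M. symmetric_mat M \<and> bipartite (support_vertices M) (support_edges M)}
     (\<lambda>M \<tau>.
        (accepts \<tau> \<longleftrightarrow> (\<exists>s. invertible_symmetric_signing M s)) \<and>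
        (accepts \<tau> \<longrightarrow> invertible_symmetric_signing M (output_mat (dim_row M) \<tau>)))"
proof -
  obtain p where p: "\<And>N. cbound N signing_algorithm = poly p N" using cbound_poly by blast
  \<comment> \<open>The inner polynomial is \<open>N = (n + 1)^2\<close> as a function of
    \<open>n\<close>.\<close>
  define P where "P = p \<circ>\<^sub>p [:1, 1:]\<^sup>2"
  have P: "poly P k = cbound ((k + 1)\<^sup>2) signing_algorithm" for k
    by (simp add: P_def poly_pcompose p)
  \<comment> \<open>This is \<open>B + 1\<close> for the weight bound
    \<open>B = 2 * (3 ^ 5 * E + 1)\<close>, which \<open>bit_weight_le\<close> gives for numbers of
    level 5; \<open>R\<close> is the same expression as a polynomial in \<open>S\<close>.\<close>
  define W where "W = (\<lambda>S :: nat. 2 * (3 ^ 5 * (4 * S\<^sup>2 + S + 1) + 1) + 1)"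
  define R where "R = [:3 + 2 * 3 ^ 5, 2 * 3 ^ 5, 8 * 3 ^ 5 :: nat:]"
  have R: "poly R S = W S" for S
    by (simp add: R_def W_def power2_eq_square algebra_simps)
  have "\<exists>\<tau>. ((accepts \<tau> \<longleftrightarrow> (\<exists>s. invertible_symmetric_signing M s)) \<and>
        (accepts \<tau> \<longrightarrow> invertible_symmetric_signing M (output_mat (dim_row M) \<tau>))) \<and>
      (\<exists>t. exec unit_weight signing_algorithm (input_state M) t \<tau> \<and> t \<le> poly P (dim_row M)) \<and>
      (elements_mat M \<subseteq> \<rat> \<longrightarrow>
        (\<exists>t. exec bit_weight signing_algorithm (input_state M) t \<tau> \<and> t \<le> poly (P * R) (bit_size M)))"
    if sym: "symmetric_mat M" and bip: "bipartite (support_vertices M) (support_edges M)" for M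
  proof -
    define n where "n = dim_row M"
    define A where "A = (\<lambda>i j. M $$ (i, j))"
    have M: "M \<in> carrier_mat n n" using sym by (auto simp: symmetric_mat_def n_def)
    have MA: "M $$ (i, j) = A i j" for i j by (simp add: A_def)
    have A_sym: "A i j = A j i" if "i < n" "j < n" for i j
      using sym that M unfolding symmetric_mat_def A_def by (metis carrier_matD index_transpose_mat(1))
    obtain X Y where XY: "X \<inter> Y = {}" "\<forall>e\<in>support_edges M. \<exists>x\<in>X. \<exists>y\<in>Y. e = {x, y}"
      using bip by (auto simp: bipartite_def)
    define side where "side v \<longleftrightarrow> v \<in> X" for v
    have A_side: "side i \<noteq> side j" if "i < n" "j < n" "A i j \<noteq> 0" for i j
    proof -
      have "{i, j} \<in> support_edges M" using that by (auto simp: support_edges_def n_def A_def)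
      then obtain x y where "x \<in> X" "y \<in> Y" "{i, j} = {x, y}" using XY(2) by blast
      then show ?thesis using XY(1) by (auto simp: side_def doubleton_eq_iff)
    qed
    \<comment> \<open>Under unit cost the numbers carry no weight, so all levels may be
      everything.\<close>
    interpret U: bipartite_input n A side "\<lambda>_. UNIV"
      by unfold_locales (assumption | rule A_sym A_side UNIV_I subset_UNIV)+
    obtain \<tau> where \<tau>: "runs UNIV signing_algorithm (input_state M) (poly P n) \<tau>"
      "accepts \<tau> \<longleftrightarrow> (\<exists>s. invertible_symmetric_signing M s)"
      "accepts \<tau> \<longrightarrow> invertible_symmetric_signing M (output_mat n \<tau>)"
      using U.runs_signing_algorithm[OF M MA] unfolding P by blast
    obtain t where t: "exec unit_weight signing_algorithm (input_state M) t \<tau>" "t \<le> poly P n"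
      using runsE[OF \<tau>(1), of unit_weight 0] by auto
    have "\<exists>t. exec bit_weight signing_algorithm (input_state M) t \<tau> \<and> t \<le> poly (P * R) (bit_size M)"
      if rat: "elements_mat M \<subseteq> \<rat>"
    proof -
      define S where "S = bit_size M"
      define E where "E = 4 * S\<^sup>2 + S + 1"
      have A_rat: "A i j \<in> \<rat>" if "i < n" "j < n" for i j
        using rat elements_matI[OF M that refl] by (auto simp: A_def)
      have S: "S = (\<Sum>i<n. \<Sum>j<n. bit_weight (A i j))"
        using M by (simp add: S_def bit_size_def A_def)
      note inst = rational_bipartite_input[of n A side S E, OF A_sym A_side A_rat S E_def]
      interpret Q: bipartite_input n A side "\<lambda>k. rats_upto (2 ^ (3 ^ k * E))" by (rule inst)
      obtain \<tau>' where \<tau>': "runs (rats_upto (2 ^ (3 ^ 5 * E))) signing_algorithm (input_state M) (poly P n) \<tau>'"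
        using Q.runs_signing_algorithm[OF M MA] unfolding P by blast
      obtain u where u: "exec bit_weight signing_algorithm (input_state M) u \<tau>'" "u \<le> poly P n * W S"
        using runsE[OF \<tau>', of bit_weight "2 * (3 ^ 5 * E + 1)"] bit_weight_le[of _ "3 ^ 5 * E"]
        by (auto simp: W_def E_def)
      \<comment> \<open>The final state does not depend on the weight, so the output of the
        unit-cost run is also that of the run measured in bits.\<close>
      have "\<tau>' = \<tau>" using exec_final_unique[OF t(1) u(1)] .
      \<comment> \<open>The bit bound has to be a polynomial in the input length alone; the
        dimension is at most that length, as every entry has weight at least 1.\<close>
      moreover have "poly P n \<le> poly P S"
        unfolding P using inst(2) by (intro cbound_mono power_mono) auto
      then have "u \<le> poly (P * R) S"
        using u(2) by (simp add: R) (meson mult_right_mono order_trans zero_le)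
      ultimately show ?thesis using u(1) by (auto simp: S_def)
    qed
    with \<tau> t show ?thesis unfolding n_def by blast
  qed
  then show ?thesis unfolding poly_time_algorithm_def by blast
qed

end
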